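(* Let $0<\beta<\pi$, $\gamma\in[0,2\pi)$, $\theta\in\mathbb{R}$ and let $n$ be a positive integer. Let $f=h+\overline{g}\in\mathcal{S}^0(\Omega_\beta)$ have dilatation $\omega(z)=g'(z)/h'(z)=e^{i\theta}z^n$. If $a\in\left[\frac{n-2}{n+2},1\right)$, then $f\ast f^a_\gamma$ is convex in the direction $-\gamma$, where $f^a_\gamma=h^a_\gamma+\overline{g^a_\gamma}\in\mathcal{S}(H_\gamma)$ is the slanted half-plane mapping determined by $$h^a_\gamma(z)+e^{-2i\gamma}g^a_\gamma(z)=\frac{(1+a)z}{1-e^{i\gamma}z},\qquad \frac{(g^a_\gamma)'(z)}{(h^a_\gamma)'(z)}=-e^{2i\gamma}\frac{e^{i\gamma}z-a}{1-ae^{i\gamma}z}.$$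
   Context: $\mathbb{D}=\{z\in\mathbb{C}:|z|<1\}$. A complex-valued harmonic mapping $f$ on $\mathbb{D}$ is written canonically as $f=h+\overline{g}$ with $h,g$ analytic in $\mathbb{D}$ and $g(0)=0$; its dilatation is $\omega=g'/h'$. $\mathcal{H}$ is the class of harmonic $f=h+\overline{g}$ on $\mathbb{D}$ with $h(0)=g(0)=0$ and $h'(0)=1$; $\mathcal{H}_0$ consists of those $f\in\mathcal{H}$ with $g'(0)=0$. $\mathcal{S}_H$ is the family of all sense-preserving univalent harmonic mappings in $\mathcal{H}$ (sense-preserving and locally univalent means $|h'(z)|>|g'(z)|$ in $\mathbb{D}$), and $\mathcal{S}_H^0=\mathcal{S}_H\cap\mathcal{H}_0$. Strip mappings: for $0<\beta<\pi$, $\mathcal{S}^0(\Omega_\beta)$ is the class of $f\in\mathcal{S}_H^0$ that map $\mathbb{D}$ onto the asymmetric vertical strip $\Omega_\beta=\{w:\frac{\beta-\pi}{2\sin\beta}<\operatorname{Re}w<\frac{\beta}{2\sin\beta}\}$; each such $f=h+\overline{g}$ satisfies $h(z)+g(z)=\frac{1}{2i\sin\beta}\log\left(\frac{1+ze^{i\beta}}{1+ze^{-i\beta}}\right)$. Slanted half-plane mappings: for $0\le\gamma<2\pi$, $\mathcal{S}(H_\gamma)$ is the class of $f=h+\overline{g}\in\mathcal{S}_H$ that map $\mathbb{D}$ onto $\{w:\operatorname{Re}(e^{i\gamma}w)>-(1+a)/2\}$ for some $-1<a<1$; such a mapping satisfies $h(z)+e^{-2i\gamma}g(z)=\frac{(1+a)z}{1-e^{i\gamma}z}$,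 so that $g'(0)=e^{2i\gamma}a$. Explicitly, with $I_\gamma(z)=\frac{z}{1-e^{i\gamma}z}$, the mapping $f^a_\gamma$ is given by $h^a_\gamma(z)=\frac{(1+a)I_\gamma(z)+(1-a)zI_\gamma'(z)}{2}$ and $g^a_\gamma(z)=e^{2i\gamma}\,\frac{(1+a)I_\gamma(z)-(1-a)zI_\gamma'(z)}{2}$. Convolution: for $f=h+\overline{g}$ and $F=H+\overline{G}$ in $\mathcal{H}$, with $h(z)=\sum a_nz^n$, $g(z)=\sum b_nz^n$, $H(z)=\sum A_nz^n$, $G(z)=\sum B_nz^n$, set $f\ast F=h\ast H+\overline{g\ast G}$, where $(h\ast H)(z)=\sum a_nA_nz^n$ and $(g\ast G)(z)=\sum b_nB_nz^n$ (Hadamard product). "Convex in the direction $\alpha$" ($\alpha$ real, understood modulo $\pi$), said of a harmonic mapping $f$ on $\mathbb{D}$, means that $f$ is univalent and the intersection of $f(\mathbb{D})$ with each line parallel to the line through $0$ and $e^{i\alpha}$ is an interval (connected) or empty. *)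

theory Defs
  imports "HOL-Complex_Analysis.Complex_Analysis"
begin

abbreviation unit_disc :: "complex set" where
  "unit_disc \<equiv> ball 0 1"

(* The disc is simply connected, so the complex-valued harmonic mappings on it are exactly the
   functions that admit such a decomposition. By canonical_decomp_unique below, h and g are
   determined on the disc by f, so the existential quantifiers over h and g in the class
   definitions all refer to the same pair. Values outside the disc are irrelevant throughout. *)
definition canonical_decomp ::
    "(complex \<Rightarrow> complex) \<Rightarrow> (complex \<Rightarrow> complex) \<Rightarrow> (complex \<Rightarrow> complex) \<Rightarrow> bool" where
  "canonical_decomp f h g \<longleftrightarrow>
     h holomorphic_on unit_disc \<and> g holomorphic_on unit_disc \<and> g 0 = 0 \<and>
     (\<forall>z\<in>unit_disc. f z = h z + cnj (g z))"

definition harmonic_mapping :: "(complex \<Rightarrow> complex) \<Rightarrow> bool" where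
  "harmonic_mapping f \<longleftrightarrow> (\<exists>h g. canonical_decomp f h g)"

definition class_H :: "(complex \<Rightarrow> complex) set" where
  "class_H = {f. \<exists>h g. canonical_decomp f h g \<and> h 0 = 0 \<and> deriv h 0 = 1}"

definition class_H0 :: "(complex \<Rightarrow> complex) set" where
  "class_H0 = {f \<in> class_H. \<exists>h g. canonical_decomp f h g \<and> deriv g 0 = 0}"

definition sense_preserving :: "(complex \<Rightarrow> complex) \<Rightarrow> bool" where
  "sense_preserving f \<longleftrightarrow>
     (\<exists>h g. canonical_decomp f h g \<and> (\<forall>z\<in>unit_disc. cmod (deriv h z) > cmod (deriv g z)))"

definition class_SH :: "(complex \<Rightarrow> complex) set" where
  "class_SH = {f \<in> class_H. sense_preserving f \<and> inj_on f unit_disc}"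

definition class_SH0 :: "(complex \<Rightarrow> complex) set" where
  "class_SH0 = class_SH \<inter> class_H0"

definition vertical_strip :: "real \<Rightarrow> complex set" where
  "vertical_strip \<beta> = {w. (\<beta> - pi) / (2 * sin \<beta>) < Re w \<and> Re w < \<beta> / (2 * sin \<beta>)}"

definition strip_mappings :: "real \<Rightarrow> (complex \<Rightarrow> complex) set" where
  "strip_mappings \<beta> = {f \<in> class_SH0. f ` unit_disc = vertical_strip \<beta>}"

definition halfplane_mappings :: "real \<Rightarrow> (complex \<Rightarrow> complex) set" where
  "halfplane_mappings \<gamma> =
     {f \<in> class_SH. \<exists>a::real. -1 < a \<and> a < 1 \<and>
        f ` unit_disc = {w. Re (cis \<gamma> * w) > - (1 + a) / 2}}"

definition hadamard_product ::
    "(complex \<Rightarrow> complex) \<Rightarrow> (complex \<Rightarrow> complex) \<Rightarrow> complex \<Rightarrow> complex" where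
  "hadamard_product h H z =
     (\<Sum>n. fps_nth (fps_expansion h 0) n * fps_nth (fps_expansion H 0) n * z ^ n)"

(* The convolution of f = h + cnj g and F = H + cnj G, as a function of the canonical parts. *)
definition harmonic_convolution ::
    "(complex \<Rightarrow> complex) \<Rightarrow> (complex \<Rightarrow> complex) \<Rightarrow> (complex \<Rightarrow> complex) \<Rightarrow> (complex \<Rightarrow> complex) \<Rightarrow>
     complex \<Rightarrow> complex" where
  "harmonic_convolution h g H G z = hadamard_product h H z + cnj (hadamard_product g G z)"

definition convex_in_direction :: "(complex \<Rightarrow> complex) \<Rightarrow> real \<Rightarrow> bool" where
  "convex_in_direction f \<alpha> \<longleftrightarrow>
     harmonic_mapping f \<and> inj_on f unit_disc \<and>
     (\<forall>p. connected (f ` unit_disc \<inter> range (\<lambda>t::real. p + of_real t * cis \<alpha>)))"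

lemma real_valued_holomorphic_constant:
  assumes "f holomorphic_on unit_disc" and "\<And>z. z \<in> unit_disc \<Longrightarrow> Im (f z) = 0"
    and "z \<in> unit_disc"
  shows "f z = f 0"
proof -
  have "f constant_on unit_disc"
  proof (rule ccontr)
    assume "\<not> f constant_on unit_disc"
    then have "open (f ` unit_disc)"
      by (intro open_mapping_thm[OF assms(1)]) auto
    moreover have "f 0 \<in> f ` unit_disc" by auto
    ultimately obtain e where e: "e > 0" "ball (f 0) e \<subseteq> f ` unit_disc"
      by (meson openE)
    have "f 0 + of_real (e/2) * \<i> \<in> ball (f 0) e"
      using e(1) by (simp add: dist_norm norm_mult)
    then obtain w where w: "w \<in> unit_disc" "f w = f 0 + of_real (e/2) * \<i>"
      using e(2) by (metis (no_types, lifting) imageE in_mono)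
    have "Im (f w) = Im (f 0) + e/2" by (simp add: w(2))
    then show False using assms(2)[of w] assms(2)[of 0] w(1) e(1) by simp
  qed
  then show ?thesis using assms(3) unfolding constant_on_def
    by (metis centre_in_ball zero_less_one)
qed

lemma canonical_decomp_unique:
  assumes "canonical_decomp f h g" "canonical_decomp f h' g'" "z \<in> unit_disc"
  shows "h z = h' z \<and> g z = g' z"
proof -
  define k where "k = (\<lambda>z. h z - h' z)"
  define l where "l = (\<lambda>z. g' z - g z)"
  have hol: "k holomorphic_on unit_disc" "l holomorphic_on unit_disc"
    using assms(1,2) unfolding canonical_decomp_def k_def l_def
    by (auto intro!: holomorphic_intros)
  have kl: "k w = cnj (l w)" if "w \<in> unit_disc" for w
  proof -
    have "h w + cnj (g w) = h' w + cnj (g' w)"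
      using assms(1,2) that unfolding canonical_decomp_def by metis
    then show ?thesis by (simp add: k_def l_def algebra_simps)
  qed
  have l0: "l 0 = 0" using assms(1,2) by (simp add: canonical_decomp_def l_def)
  have k0: "k 0 = 0" using kl[of 0] l0 by simp
  have "(\<lambda>w. k w + l w) z = (\<lambda>w. k w + l w) 0"
    by (rule real_valued_holomorphic_constant)
       (use hol kl assms(3) in \<open>auto intro!: holomorphic_intros\<close>)
  moreover have "(\<lambda>w. \<i> * (k w - l w)) z = (\<lambda>w. \<i> * (k w - l w)) 0"
    by (rule real_valued_holomorphic_constant)
       (use hol kl assms(3) in \<open>auto intro!: holomorphic_intros\<close>)
  ultimately have "k z + l z = 0" "k z - l z = 0" using k0 l0 by auto
  then have "k z = 0" "l z = 0" by (auto simp: complex_eq_iff)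
  then show ?thesis by (simp add: k_def l_def)
qed

definition halfplane_kernel :: "real \<Rightarrow> complex \<Rightarrow> complex" where
  "halfplane_kernel \<gamma> z = z / (1 - cis \<gamma> * z)"

definition halfplane_h :: "real \<Rightarrow> real \<Rightarrow> complex \<Rightarrow> complex" where
  "halfplane_h a \<gamma> z =
     ((1 + of_real a) * halfplane_kernel \<gamma> z +
      (1 - of_real a) * z * deriv (halfplane_kernel \<gamma>) z) / 2"

definition halfplane_g :: "real \<Rightarrow> real \<Rightarrow> complex \<Rightarrow> complex" where
  "halfplane_g a \<gamma> z = cis (2 * \<gamma>) *
     ((1 + of_real a) * halfplane_kernel \<gamma> z -
      (1 - of_real a) * z * deriv (halfplane_kernel \<gamma>) z) / 2"

lemma one_minus_cis_mult_nonzero: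
  assumes "z \<in> unit_disc" shows "1 - cis \<gamma> * z \<noteq> 0"
proof
  assume "1 - cis \<gamma> * z = 0"
  then have "cis \<gamma> * z = 1" by simp
  then have "cmod (cis \<gamma> * z) = 1" by simp
  then show False using assms by (simp add: norm_mult)
qed

lemma deriv_halfplane_kernel:
  assumes "z \<in> unit_disc"
  shows "deriv (halfplane_kernel \<gamma>) z = 1 / (1 - cis \<gamma> * z)\<^sup>2"
proof -
  have "((\<lambda>z. z / (1 - cis \<gamma> * z)) has_field_derivative 1 / (1 - cis \<gamma> * z)\<^sup>2) (at z)"
    using one_minus_cis_mult_nonzero[OF assms, of \<gamma>]
    by (auto intro!: derivative_eq_intros simp: field_simps power2_eq_square)
  then show ?thesis
    unfolding halfplane_kernel_def by (rule DERIV_imp_deriv)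
qed

lemma cis_double: "cis (2 * \<gamma>) = (cis \<gamma>)\<^sup>2"
  by (simp add: power2_eq_square cis_mult)

lemma halfplane_h_g_eq:
  assumes "z \<in> unit_disc"
  shows "halfplane_h a \<gamma> z =
           ((1 + of_real a) * (z / (1 - cis \<gamma> * z)) + (1 - of_real a) * (z / (1 - cis \<gamma> * z)\<^sup>2)) / 2"
    and "halfplane_g a \<gamma> z = (cis \<gamma>)\<^sup>2 *
           ((1 + of_real a) * (z / (1 - cis \<gamma> * z)) - (1 - of_real a) * (z / (1 - cis \<gamma> * z)\<^sup>2)) / 2"
  by (simp_all add: halfplane_h_def halfplane_g_def halfplane_kernel_def
      deriv_halfplane_kernel[OF assms] cis_double)

lemma halfplane_h_g_deriv:
  assumes z: "z \<in> unit_disc"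
  shows "(halfplane_h a \<gamma> has_field_derivative
            (1 - of_real a * cis \<gamma> * z) / (1 - cis \<gamma> * z) ^ 3) (at z)"
    and "(halfplane_g a \<gamma> has_field_derivative
            (cis \<gamma>)\<^sup>2 * (of_real a - cis \<gamma> * z) / (1 - cis \<gamma> * z) ^ 3) (at z)"
proof -
  define d where "d = 1 - cis \<gamma> * z"
  have d: "d \<noteq> 0" using one_minus_cis_mult_nonzero[OF z] by (simp add: d_def)
  have c: "cis \<gamma> * z = 1 - d" by (simp add: d_def)
  have e1: "1 - of_real a * cis \<gamma> * z = 1 - of_real a * (1 - d)"
    and e2: "of_real a - cis \<gamma> * z = of_real a - (1 - d)"
    by (simp_all add: d_def)
  have 1: "((\<lambda>z. z / (1 - cis \<gamma> * z)) has_field_derivative 1 / d\<^sup>2) (at z)"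
    using d unfolding d_def
    by (auto intro!: derivative_eq_intros simp: field_simps power2_eq_square)
  have num: "d\<^sup>2 + 2 * (1 - d) * d = (2 - d) * d"
    by (simp add: power2_eq_square algebra_simps)
  have "((\<lambda>z. z / (1 - cis \<gamma> * z)\<^sup>2) has_field_derivative
          (1 * d\<^sup>2 - z * (2 * d * (- cis \<gamma>))) / (d\<^sup>2 * d\<^sup>2)) (at z)"
    using d unfolding d_def
    by (auto intro!: derivative_eq_intros)
  moreover have "(1 * d\<^sup>2 - z * (2 * d * (- cis \<gamma>))) / (d\<^sup>2 * d\<^sup>2) = (2 - d) / d ^ 3"
  proof -
    have "1 * d\<^sup>2 - z * (2 * d * (- cis \<gamma>)) = d\<^sup>2 + 2 * (cis \<gamma> * z) * d" by simp
    also have "\<dots> = (2 - d) * d" using num by (simp only: c)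
    finally have "1 * d\<^sup>2 - z * (2 * d * (- cis \<gamma>)) = (2 - d) * d" .
    moreover have "(2 - d) * d / (d\<^sup>2 * d\<^sup>2) = (2 - d) / d ^ 3"
      using d by (simp add: power2_eq_square power3_eq_cube)
    ultimately show ?thesis by simp
  qed
  ultimately have 2: "((\<lambda>z. z / (1 - cis \<gamma> * z)\<^sup>2) has_field_derivative (2 - d) / d ^ 3) (at z)"
    by simp
  have 3: "1 / d\<^sup>2 = d / d ^ 3" using d by (simp add: power2_eq_square power3_eq_cube)
  let ?A = "1 + of_real a :: complex" and ?B = "1 - of_real a :: complex"
  have "((\<lambda>z. (?A * (z / (1 - cis \<gamma> * z)) + ?B * (z / (1 - cis \<gamma> * z)\<^sup>2)) / 2)
      has_field_derivative (?A * (1 / d\<^sup>2) + ?B * ((2 - d) / d ^ 3)) / 2) (at z)"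
    by (intro DERIV_cdivide DERIV_add DERIV_cmult 1 2)
  also have "(?A * (1 / d\<^sup>2) + ?B * ((2 - d) / d ^ 3)) / 2 = (1 - of_real a * (1 - d)) / d ^ 3"
    unfolding 3 using d by (simp add: field_simps)
  finally show "(halfplane_h a \<gamma> has_field_derivative
            (1 - of_real a * cis \<gamma> * z) / (1 - cis \<gamma> * z) ^ 3) (at z)"
    unfolding e1 unfolding d_def[symmetric]
    by (rule has_field_derivative_transform_within_open[OF _ open_ball z])
       (simp add: halfplane_h_g_eq)
  have "((\<lambda>z. (cis \<gamma>)\<^sup>2 * (?A * (z / (1 - cis \<gamma> * z)) - ?B * (z / (1 - cis \<gamma> * z)\<^sup>2)) / 2)
      has_field_derivative (cis \<gamma>)\<^sup>2 * (?A * (1 / d\<^sup>2) - ?B * ((2 - d) / d ^ 3)) / 2) (at z)"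
    by (intro DERIV_cdivide DERIV_diff DERIV_cmult 1 2)
  also have "(cis \<gamma>)\<^sup>2 * (?A * (1 / d\<^sup>2) - ?B * ((2 - d) / d ^ 3)) / 2
      = (cis \<gamma>)\<^sup>2 * (of_real a - (1 - d)) / d ^ 3"
    unfolding 3 using d by (simp add: field_simps)
  finally show "(halfplane_g a \<gamma> has_field_derivative
            (cis \<gamma>)\<^sup>2 * (of_real a - cis \<gamma> * z) / (1 - cis \<gamma> * z) ^ 3) (at z)"
    unfolding e2 unfolding d_def[symmetric]
    by (rule has_field_derivative_transform_within_open[OF _ open_ball z])
       (simp add: halfplane_h_g_eq)
qed

lemma halfplane_shear:
  assumes "z \<in> unit_disc"
  shows "halfplane_h a \<gamma> z + cis (- 2 * \<gamma>) * halfplane_g a \<gamma> z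
           = (1 + of_real a) * z / (1 - cis \<gamma> * z)"
proof -
  have "cis (- 2 * \<gamma>) * cis (2 * \<gamma>) = 1" by (simp add: cis_mult)
  then have "cis (- 2 * \<gamma>) * halfplane_g a \<gamma> z =
     ((1 + of_real a) * halfplane_kernel \<gamma> z -
      (1 - of_real a) * z * deriv (halfplane_kernel \<gamma>) z) / 2"
    unfolding halfplane_g_def by (metis mult.assoc mult.left_neutral times_divide_eq_right)
  moreover have "(x + y) / 2 + (x - y) / 2 = x" for x y :: complex
    by (simp add: field_simps)
  ultimately have "halfplane_h a \<gamma> z + cis (- 2 * \<gamma>) * halfplane_g a \<gamma> z
      = (1 + of_real a) * halfplane_kernel \<gamma> z"
    unfolding halfplane_h_def by metis
  then show ?thesis by (simp add: halfplane_kernel_def)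
qed

lemma dilatation_denominator_nonzero:
  assumes "-1 < a" "a < 1" "z \<in> unit_disc"
  shows "1 - of_real a * cis \<gamma> * z \<noteq> 0"
proof
  assume "1 - of_real a * cis \<gamma> * z = 0"
  then have "of_real a * cis \<gamma> * z = 1" by simp
  then have "cmod (of_real a * cis \<gamma> * z) = 1" by simp
  then have "\<bar>a\<bar> * cmod z = 1" by (simp add: norm_mult)
  moreover have "\<bar>a\<bar> * cmod z \<le> 1 * cmod z" using assms by (intro mult_right_mono) auto
  ultimately show False using assms(3) by simp
qed

lemma halfplane_dilatation:
  assumes "-1 < a" "a < 1" and z: "z \<in> unit_disc"
  shows "deriv (halfplane_g a \<gamma>) z / deriv (halfplane_h a \<gamma>) z
           = - cis (2 * \<gamma>) * ((cis \<gamma> * z - of_real a) / (1 - of_real a * cis \<gamma> * z))"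
  using one_minus_cis_mult_nonzero[OF z, of \<gamma>] dilatation_denominator_nonzero[OF assms, of \<gamma>]
  unfolding cis_double
  by (simp add: halfplane_h_g_deriv[OF z, THEN DERIV_imp_deriv] field_simps)

(* For every -1 < a < 1 the slanted half-plane mapping determined by the shear and dilatation
   equations exists: it is halfplane_h + cnj halfplane_g. *)
lemma halfplane_canonical_decomp:
  "canonical_decomp (\<lambda>z. halfplane_h a \<gamma> z + cnj (halfplane_g a \<gamma> z)) (halfplane_h a \<gamma>) (halfplane_g a \<gamma>)"
proof -
  have "halfplane_h a \<gamma> holomorphic_on unit_disc" "halfplane_g a \<gamma> holomorphic_on unit_disc"
    unfolding holomorphic_on_def field_differentiable_def
    by (meson halfplane_h_g_deriv has_field_derivative_at_within)+
  then show ?thesis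
    by (simp add: canonical_decomp_def halfplane_g_def halfplane_kernel_def)
qed

lemma halfplane_in_class:
  assumes a: "-1 < a" "a < 1"
  shows "(\<lambda>z. halfplane_h a \<gamma> z + cnj (halfplane_g a \<gamma> z)) \<in> halfplane_mappings \<gamma>"
proof -
  define f where "f = (\<lambda>z. halfplane_h a \<gamma> z + cnj (halfplane_g a \<gamma> z))"
  define s where "s = (\<lambda>z. cis \<gamma> * z / (1 - cis \<gamma> * z))"
  have cc: "cis \<gamma> * cnj (cis \<gamma>) = 1" by (simp add: cis_cnj cis_mult)
  have dec: "canonical_decomp f (halfplane_h a \<gamma>) (halfplane_g a \<gamma>)"
    unfolding f_def by (rule halfplane_canonical_decomp)
  have H: "f \<in> class_H"
    unfolding class_H_def using dec halfplane_h_g_deriv(1)[of 0 a \<gamma>, THEN DERIV_imp_deriv]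
    by (auto simp: halfplane_h_def halfplane_kernel_def intro!: exI)
  have sp: "sense_preserving f"
    unfolding sense_preserving_def
  proof (intro exI conjI ballI)
    show "canonical_decomp f (halfplane_h a \<gamma>) (halfplane_g a \<gamma>)" by (rule dec)
    fix z assume z: "z \<in> unit_disc"
    define w where "w = cis \<gamma> * z"
    have "cmod w < 1" using z by (simp add: w_def norm_mult)
    then have w: "(Re w)\<^sup>2 + (Im w)\<^sup>2 < 1"
      by (metis cmod_power2 norm_ge_zero power_less_one_iff zero_less_numeral)
    have "a\<^sup>2 < 1" using a by (simp add: abs_square_less_1 abs_less_iff)
    then have "(1 - a\<^sup>2) * (1 - ((Re w)\<^sup>2 + (Im w)\<^sup>2)) > 0" using w by simp
    then have "(cmod (of_real a - w))\<^sup>2 < (cmod (1 - of_real a * w))\<^sup>2"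
      unfolding cmod_power2 by (simp add: power2_eq_square algebra_simps)
    then have lt: "cmod (of_real a - w) < cmod (1 - of_real a * w)"
      using norm_ge_zero power2_less_imp_less by blast
    have "1 - w \<noteq> 0" using one_minus_cis_mult_nonzero[OF z] by (simp add: w_def)
    then have "cmod (1 - w) ^ 3 > 0" by simp
    then show "cmod (deriv (halfplane_g a \<gamma>) z) < cmod (deriv (halfplane_h a \<gamma>) z)"
      using lt unfolding w_def
      by (simp add: halfplane_h_g_deriv[OF z, THEN DERIV_imp_deriv] norm_divide norm_mult
          norm_power divide_strict_right_mono mult.assoc)
  qed
  have fs: "cis \<gamma> * f z = Complex ((1 + a) * Re (s z)) ((1 - a) * (Im (s z) * (1 + 2 * Re (s z))))"
    if z: "z \<in> unit_disc" for z
  proof -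
    define d where "d = 1 - cis \<gamma> * z"
    have d: "d \<noteq> 0" using one_minus_cis_mult_nonzero[OF z] by (simp add: d_def)
    define u where "u = s z"
    define v where "v = cis \<gamma> * (z / (1 - cis \<gamma> * z)\<^sup>2)"
    have u: "u = cis \<gamma> * (z / (1 - cis \<gamma> * z))" by (simp add: u_def s_def)
    have v: "v = u + u\<^sup>2"
    proof -
      have "v = (1 - d) / d\<^sup>2" "u = (1 - d) / d" by (simp_all add: v_def u d_def)
      moreover have "(1 - d) / d\<^sup>2 = (1 - d) / d + ((1 - d) / d)\<^sup>2"
        using d by (simp add: field_simps power2_eq_square)
      ultimately show ?thesis by simp
    qed
    let ?A = "1 + of_real a :: complex" and ?B = "1 - of_real a :: complex"
    have 1: "cis \<gamma> * halfplane_h a \<gamma> z = (?A * u + ?B * v) / 2"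
      by (simp add: halfplane_h_g_eq[OF z] u v_def algebra_simps)
    have g: "halfplane_g a \<gamma> z = cis \<gamma> * ((?A * u - ?B * v) / 2)"
      by (simp add: halfplane_h_g_eq[OF z] u v_def algebra_simps power2_eq_square)
    have 2: "cis \<gamma> * cnj (halfplane_g a \<gamma> z) = cnj ((?A * u - ?B * v) / 2)"
      unfolding g complex_cnj_mult using cc by (metis mult.assoc mult.left_neutral)
    have "cis \<gamma> * f z = (?A * u + ?B * v) / 2 + cnj ((?A * u - ?B * v) / 2)"
      unfolding f_def distrib_left 1 2 ..
    also have "\<dots> = Complex ((1 + a) * Re u) ((1 - a) * (Im u * (1 + 2 * Re u)))"
      by (simp add: complex_eq_iff v power2_eq_square field_simps)
    finally show ?thesis by (simp add: u_def)
  qed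
  have s_inv: "s z / (1 + s z) = cis \<gamma> * z" "1 + s z \<noteq> 0" if "z \<in> unit_disc" for z
  proof -
    have "1 + s z = 1 / (1 - cis \<gamma> * z)"
      using one_minus_cis_mult_nonzero[OF that, of \<gamma>] by (simp add: s_def field_simps)
    then show "s z / (1 + s z) = cis \<gamma> * z" "1 + s z \<noteq> 0"
      using one_minus_cis_mult_nonzero[OF that, of \<gamma>] by (auto simp: s_def)
  qed
  have norm_iff: "cmod (u / (1 + u)) < 1 \<longleftrightarrow> Re u > -1/2" if "1 + u \<noteq> 0" for u
  proof -
    have "cmod (u / (1 + u)) < 1 \<longleftrightarrow> cmod u < cmod (1 + u)"
      using that by (simp add: norm_divide)
    also have "\<dots> \<longleftrightarrow> (cmod u)\<^sup>2 < (cmod (1 + u))\<^sup>2"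
      by (meson norm_ge_zero power2_less_imp_less power_strict_mono zero_less_numeral)
    also have "\<dots> \<longleftrightarrow> Re u > -1/2"
      unfolding cmod_power2 by (auto simp: power2_eq_square algebra_simps)
    finally show ?thesis .
  qed
  have s_half: "Re (s z) > -1/2" if "z \<in> unit_disc" for z
    using norm_iff[OF s_inv(2)[OF that]] s_inv(1)[OF that] that by (simp add: norm_mult)
  have inj: "inj_on f unit_disc"
  proof
    fix x y assume x: "x \<in> unit_disc" and y: "y \<in> unit_disc" and "f x = f y"
    then have eq: "(1 + a) * Re (s x) = (1 + a) * Re (s y)"
      "(1 - a) * (Im (s x) * (1 + 2 * Re (s x))) = (1 - a) * (Im (s y) * (1 + 2 * Re (s y)))"
      using fs[OF x] fs[OF y] by auto
    then have "Re (s x) = Re (s y)" using a by simp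
    moreover have "Im (s x) = Im (s y)"
      using eq(2) a s_half[OF y] unfolding \<open>Re (s x) = Re (s y)\<close> by simp
    ultimately have "s x = s y" by (simp add: complex_eq_iff)
    then have "cis \<gamma> * x = cis \<gamma> * y" using s_inv(1)[OF x] s_inv(1)[OF y] by metis
    then show "x = y" by simp
  qed
  have img: "f ` unit_disc = {w. Re (cis \<gamma> * w) > - (1 + a) / 2}"
  proof (intro equalityI subsetI)
    fix w assume "w \<in> f ` unit_disc"
    then obtain z where z: "z \<in> unit_disc" "w = f z" by auto
    have "(1 + a) * (Re (s z) + 1/2) > 0"
      using a s_half[OF z(1)] by (intro mult_pos_pos) auto
    moreover have "Re (cis \<gamma> * w) = (1 + a) * Re (s z)"
      unfolding z(2) fs[OF z(1)] by simp
    moreover have "(1 + a) * (Re (s z) + 1/2) = (1 + a) * Re (s z) + (1 + a) / 2"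
      by (simp add: algebra_simps)
    ultimately have "Re (cis \<gamma> * w) > - (1 + a) / 2" by linarith
    then show "w \<in> {w. Re (cis \<gamma> * w) > - (1 + a) / 2}" by (rule CollectI)
  next
    fix w assume w: "w \<in> {w. Re (cis \<gamma> * w) > - (1 + a) / 2}"
    define p where "p = cis \<gamma> * w"
    define x where "x = Re p / (1 + a)"
    define u where "u = Complex x (Im p / ((1 - a) * (1 + 2 * x)))"
    have x: "x > -1/2" using w a by (simp add: x_def p_def field_simps)
    have u1: "1 + u \<noteq> 0" using x by (auto simp: complex_eq_iff u_def)
    define z where "z = cnj (cis \<gamma>) * (u / (1 + u))"
    have cz: "cis \<gamma> * z = u / (1 + u)"
      unfolding z_def using cc by (metis mult.assoc mult.left_neutral)
    have "cmod (u / (1 + u)) < 1" using norm_iff[OF u1] x by (simp add: u_def)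
    then have z: "z \<in> unit_disc" using cz by (metis dist_0_norm mem_ball mult_1 norm_cis norm_mult)
    have "s z = u" unfolding s_def cz using u1 by (simp add: field_simps)
    then have "cis \<gamma> * f z = p"
      using a x unfolding fs[OF z] by (simp add: complex_eq_iff u_def x_def)
    then have "f z = w" by (simp add: p_def)
    then show "w \<in> f ` unit_disc" using z by auto
  qed
  show ?thesis
    unfolding f_def[symmetric] halfplane_mappings_def class_SH_def
    using H sp inj img a by auto
qed

end

(* Re f = Re (h + g), so k = h + g maps the disc into the strip; the Schwarz lemma, applied to k
   followed by the explicit conformal map Z of the strip onto the disc, forces k to be the inverse
   of Z. With b = (1 - a) / 2, the convolution is z |-> e^(-i gamma) N(k(e^(i gamma) z)), where on
   the strip N = u + cnj v and u(k z) = (1 - b) h z + b z h' z, v(k z) = (1 - b) g z - b z g' z.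
   In the coordinate w = k z, writing omega = e^(i theta) Z^n and kappa = Z / Z', one has
   u' = (c + Y) / (1 + omega) and v' = omega (c - Y) / (1 + omega) with c = 1 - b - b n / 2 and
   Y = b kappa' + (b n / 2) (1 - omega) / (1 + omega). Here Re Y > 0, and the hypothesis on a says
   that c >= 0, so |v'| < |u'|. Also Re (u' - v') >= b Re kappa', which on each vertical line has
   a positive lower bound. The shear principle on the strip then makes N injective
   with connected horizontal sections. *)
theory Submission
  imports Defs
begin

section \<open>Hadamard products with the half-plane kernel\<close>

text \<open>A geometric series times the variable. The index \<open>0\<close> is split off because
  truncated subtraction would give it the coefficient \<open>1\<close>.\<close>

lemma halfplane_kernel_has_fps_expansion:
  "halfplane_kernel \<gamma> has_fps_expansion Abs_fps (\<lambda>m. if m = 0 then 0 else cis \<gamma> ^ (m - 1))"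
proof (rule has_fps_expansionI)
  have "eventually (\<lambda>u. u \<in> unit_disc) (nhds (0::complex))"
    by (rule eventually_nhds_in_open) auto
  then show "\<forall>\<^sub>F u in nhds 0. (\<lambda>n. fps_nth (Abs_fps (\<lambda>m. if m = 0 then 0 else cis \<gamma> ^ (m - 1))) n * u ^ n)
      sums halfplane_kernel \<gamma> u"
  proof eventually_elim
    case (elim u)
    then have "(\<lambda>n. u * (cis \<gamma> * u) ^ n) sums (u * (1 / (1 - cis \<gamma> * u)))"
      by (intro sums_mult geometric_sums) (simp add: norm_mult)
    moreover have "(\<lambda>n. u * (cis \<gamma> * u) ^ n) =
        (\<lambda>n. fps_nth (Abs_fps (\<lambda>m. if m = 0 then 0 else cis \<gamma> ^ (m - 1))) (Suc n) * u ^ Suc n)"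
      by (simp add: power_mult_distrib mult_ac)
    ultimately have "(\<lambda>n. fps_nth (Abs_fps (\<lambda>m. if m = 0 then 0 else cis \<gamma> ^ (m - 1))) (Suc n) * u ^ Suc n)
        sums halfplane_kernel \<gamma> u"
      by (simp add: halfplane_kernel_def)
    from sums_Suc[OF this] show ?case by simp
  qed
qed

text \<open>The operator z d/dz multiplies the coefficient of index \<open>m\<close> by
  \<open>m\<close>. At index \<open>0\<close> the true coefficient is \<open>0\<close>, while the
  formula would give \<open>p\<close>.\<close>

lemma fps_expansion_kernel_combination:
  assumes "m > 0"
  shows "fps_nth (fps_expansion (\<lambda>z. p * halfplane_kernel \<gamma> z + q * z * deriv (halfplane_kernel \<gamma>) z) 0) m
    = (p + q * of_nat m) * cis \<gamma> ^ (m - 1)"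
proof -
  let ?K = "Abs_fps (\<lambda>m. if m = 0 then 0 else cis \<gamma> ^ (m - 1))"
  have "(\<lambda>z. p * halfplane_kernel \<gamma> z + q * (z * deriv (halfplane_kernel \<gamma>) z)) has_fps_expansion
      (fps_const p * ?K + fps_const q * (fps_X * fps_deriv ?K))"
    by (intro fps_expansion_intros halfplane_kernel_has_fps_expansion)
  then have "fps_expansion (\<lambda>z. p * halfplane_kernel \<gamma> z + q * (z * deriv (halfplane_kernel \<gamma>) z)) 0 =
      fps_const p * ?K + fps_const q * (fps_X * fps_deriv ?K)"
    by (rule fps_expansion_eqI)
  then show ?thesis
    using assms by (simp add: mult.assoc algebra_simps)
qed

text \<open>Coefficients \<open>cis \<gamma> ^ (m - 1)\<close> rotate the argument of
  \<open>h\<close> and leave one factor \<open>cis (- \<gamma>)\<close>; an additional factor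
  \<open>m\<close> produces the derivative. The kernel has no constant term, which matches
  \<open>h 0 = 0\<close>.\<close>

lemma hadamard_product_kernel_combination:
  assumes h: "h holomorphic_on unit_disc" "h 0 = 0" and z: "z \<in> unit_disc"
  shows "hadamard_product h (\<lambda>z. p * halfplane_kernel \<gamma> z + q * z * deriv (halfplane_kernel \<gamma>) z) z
    = p * cis (- \<gamma>) * h (cis \<gamma> * z) + q * z * deriv h (cis \<gamma> * z)"
proof -
  define c where "c = cis \<gamma>"
  define A where "A = (\<lambda>n. (deriv ^^ n) h 0 / fact n)"
  have ci: "cis (- \<gamma>) * c = 1"
    by (simp add: c_def cis_mult)
  have cz: "c * z \<in> unit_disc"
    using z by (simp add: c_def norm_mult)
  have s1: "(\<lambda>n. A n * (c * z) ^ n) sums h (c * z)"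
    using holomorphic_power_series[OF h(1) cz] by (simp add: A_def)
  have s2: "(\<lambda>n. A (Suc n) * of_nat (Suc n) * (c * z) ^ n) sums deriv h (c * z)"
  proof -
    have "deriv h holomorphic_on unit_disc"
      using h(1) by (intro holomorphic_deriv) auto
    from holomorphic_power_series[OF this cz]
    have sh: "(\<lambda>n. (deriv ^^ Suc n) h 0 / fact n * (c * z) ^ n) sums deriv h (c * z)"
      by (simp add: funpow_Suc_right del: funpow.simps)
    \<comment> \<open>Termwise differentiation: the Taylor coefficient of \<open>deriv h\<close> at
      index \<open>n\<close> is \<open>Suc n\<close> times that of \<open>h\<close> at index
      \<open>Suc n\<close>.\<close>
    have "(deriv ^^ Suc n) h 0 / fact n = A (Suc n) * of_nat (Suc n)" for n
    proof -
      have "d / fact n = d / (of_nat (Suc n) * fact n) * of_nat (Suc n)" for d :: complex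
        by (simp del: of_nat_Suc)
      then show ?thesis unfolding A_def fact_Suc by blast
    qed
    then show ?thesis using sh by (simp only:)
  qed
  have "(\<lambda>n. p * cis (- \<gamma>) * (A (Suc n) * (c * z) ^ Suc n) + q * z * (A (Suc n) * of_nat (Suc n) * (c * z) ^ n))
      sums (p * cis (- \<gamma>) * h (c * z) + q * z * deriv h (c * z))"
  proof (intro sums_add sums_mult s2)
    show "(\<lambda>n. A (Suc n) * (c * z) ^ Suc n) sums h (c * z)"
      using s1 h(2) by (subst sums_Suc_iff) (simp add: A_def)
  qed
  moreover have eq: "p * cis (- \<gamma>) * (A (Suc n) * (c * z) ^ Suc n) + q * z * (A (Suc n) * of_nat (Suc n) * (c * z) ^ n)
     = A (Suc n) * ((p + q * of_nat (Suc n)) * c ^ (Suc n - 1)) * z ^ Suc n" for n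
  proof -
    have "p * cis (- \<gamma>) * (A (Suc n) * (c * z) ^ Suc n) = (cis (- \<gamma>) * c) * p * A (Suc n) * c ^ n * z ^ Suc n"
      by (simp add: power_mult_distrib)
    then show ?thesis unfolding ci by (simp add: power_mult_distrib algebra_simps)
  qed
  ultimately have s: "(\<lambda>n. A (Suc n) * ((p + q * of_nat (Suc n)) * c ^ (Suc n - 1)) * z ^ Suc n)
      sums (p * cis (- \<gamma>) * h (c * z) + q * z * deriv h (c * z))"
    by (simp only: eq)
  define B where "B = fps_nth (fps_expansion (\<lambda>z. p * halfplane_kernel \<gamma> z + q * z * deriv (halfplane_kernel \<gamma>) z) 0)"
  have B: "(\<lambda>n. A (Suc n) * B (Suc n) * z ^ Suc n)
      sums (p * cis (- \<gamma>) * h (c * z) + q * z * deriv h (c * z))"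
    using s by (simp only: B_def c_def fps_expansion_kernel_combination zero_less_Suc)
  \<comment> \<open>Restoring the term of index \<open>0\<close> changes nothing, since
    \<open>A 0 = h 0 = 0\<close>.\<close>
  have "(\<lambda>n. A n * B n * z ^ n)
      sums (p * cis (- \<gamma>) * h (c * z) + q * z * deriv h (c * z))"
    using sums_Suc[OF B] h(2) by (simp add: A_def)
  then show ?thesis
    by (simp add: hadamard_product_def sums_iff A_def B_def c_def fps_expansion_def)
qed

section \<open>Two inequalities for complex numbers\<close>

text \<open>The squared moduli differ by 4 \<open>c * Re Y\<close>.\<close>

lemma norm_diff_le_norm_add:
  fixes Y :: complex
  assumes "c \<ge> 0" "Re Y \<ge> 0"
  shows "cmod (of_real c - Y) \<le> cmod (of_real c + Y)"
proof -
  have "c * Re Y \<ge> 0" using assms by simp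
  then have "(cmod (of_real c - Y))\<^sup>2 \<le> (cmod (of_real c + Y))\<^sup>2"
    unfolding cmod_power2 by (simp add: power2_eq_square algebra_simps)
  then show ?thesis by (rule power2_le_imp_le) simp
qed

text \<open>The real part equals (1 - |x|^2) / |1 + x|^2.\<close>

lemma Re_cayley_pos:
  fixes x :: complex
  assumes "cmod x < 1"
  shows "Re ((1 - x) / (1 + x)) > 0"
proof -
  have "x \<noteq> -1" using assms by auto
  then have "1 + x \<noteq> 0" by (metis add.commute eq_neg_iff_add_eq_0)
  have "(cmod x)\<^sup>2 < 1" using assms by (simp add: abs_square_less_1)
  then have lt: "(Re x)\<^sup>2 + (Im x)\<^sup>2 < 1" by (simp add: cmod_power2)
  have "(Re (1 + x))\<^sup>2 + (Im (1 + x))\<^sup>2 > 0"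
    using \<open>1 + x \<noteq> 0\<close> by (metis complex_neq_0)
  then show ?thesis unfolding Re_divide using lt
    by (intro divide_pos_pos) (auto simp: power2_eq_square algebra_simps)
qed

section \<open>The shear principle on a vertical strip\<close>

text \<open>Each vertical line meets the level set exactly once, so the set is the graph of a
  function \<tau> over an interval. By monotonicity, \<open>s < \<tau> x\<close> means
  \<open>\<phi> (Complex x s) < y\<close>, which persists for nearby \<open>x\<close>; the same
  holds for the reverse inequalities, so \<tau> is continuous.\<close>

lemma connected_level_set_strip:
  fixes \<phi> :: "complex \<Rightarrow> real"
  assumes cont: "continuous_on {w. p < Re w \<and> Re w < q} \<phi>"
    and mono: "\<And>x s t. p < x \<Longrightarrow> x < q \<Longrightarrow> s < t \<Longrightarrow> \<phi> (Complex x s) < \<phi> (Complex x t)"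
    and surj: "\<And>x. p < x \<Longrightarrow> x < q \<Longrightarrow> \<exists>t. \<phi> (Complex x t) = y"
  shows "connected {w. p < Re w \<and> Re w < q \<and> \<phi> w = y}"
proof -
  obtain \<tau> where \<tau>: "\<phi> (Complex x (\<tau> x)) = y" if "p < x" "x < q" for x
    using surj by metis
  have less_iff: "s < \<tau> x \<longleftrightarrow> \<phi> (Complex x s) < y" and gt_iff: "\<tau> x < s \<longleftrightarrow> y < \<phi> (Complex x s)"
    if "p < x" "x < q" for x s
    using mono[OF that, of s "\<tau> x"] mono[OF that, of "\<tau> x" s] \<tau>[OF that]
    by (cases s "\<tau> x" rule: linorder_cases; force)+
  have slice: "continuous_on {p<..<q} (\<lambda>x. \<phi> (Complex x s))" for s
    by (rule continuous_on_compose2[OF cont]) (auto intro!: continuous_intros)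
  have "continuous_on {p<..<q} \<tau>"
  proof (intro continuous_at_imp_continuous_on ballI)
    fix x assume x: "x \<in> {p<..<q}"
    have near: "\<forall>\<^sub>F x' in at x. x' \<in> {p<..<q}"
      using x by (intro eventually_at_in_open') auto
    have tends: "((\<lambda>x. \<phi> (Complex x s)) \<longlongrightarrow> \<phi> (Complex x s)) (at x)" for s
      using slice x by (simp add: continuous_on_eq_continuous_at isCont_def)
    show "isCont \<tau> x"
      unfolding isCont_def
    proof (rule order_tendstoI)
      fix s assume "s < \<tau> x"
      then have "\<phi> (Complex x s) < y" using less_iff x by simp
      with tends have "\<forall>\<^sub>F x' in at x. \<phi> (Complex x' s) < y" by (rule order_tendstoD)
      with near show "\<forall>\<^sub>F x' in at x. s < \<tau> x'"
        by eventually_elim (simp add: less_iff)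
    next
      fix s assume "\<tau> x < s"
      then have "y < \<phi> (Complex x s)" using gt_iff x by simp
      with tends have "\<forall>\<^sub>F x' in at x. y < \<phi> (Complex x' s)" by (rule order_tendstoD)
      with near show "\<forall>\<^sub>F x' in at x. \<tau> x' < s"
        by eventually_elim (simp add: gt_iff)
    qed
  qed
  then have "connected ((\<lambda>x. Complex x (\<tau> x)) ` {p<..<q})"
    by (intro connected_continuous_image) (auto intro!: continuous_intros)
  moreover have "(\<lambda>x. Complex x (\<tau> x)) ` {p<..<q} = {w. p < Re w \<and> Re w < q \<and> \<phi> w = y}"
  proof (intro equalityI subsetI)
    fix w assume "w \<in> {w. p < Re w \<and> Re w < q \<and> \<phi> w = y}"
    then have w: "p < Re w" "Re w < q" "\<phi> (Complex (Re w) (Im w)) = y" by auto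
    then have "\<tau> (Re w) = Im w"
      using less_iff[OF w(1,2), of "Im w"] gt_iff[OF w(1,2), of "Im w"] by linarith
    then have "w = Complex (Re w) (\<tau> (Re w))" by (simp add: complex_eq_iff)
    then show "w \<in> (\<lambda>x. Complex x (\<tau> x)) ` {p<..<q}" using w by auto
  qed (auto simp: \<tau>)
  ultimately show ?thesis by simp
qed

text \<open>Moving upwards multiplies the derivative by \<open>\<i>\<close>, and
  \<open>Im (\<i> * D) = Re D\<close>.\<close>

lemma vertical_DERIV_Im:
  assumes "(f has_field_derivative D) (at (Complex x t))"
  shows "((\<lambda>t. Im (f (Complex x t))) has_real_derivative Re D) (at t)"
proof -
  have "((\<lambda>t. Complex x t) has_vector_derivative \<i>) (at t)"
    unfolding Complex_eq by (auto intro!: derivative_eq_intros simp: has_vector_derivative_def scaleR_conv_of_real)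
  from field_vector_diff_chain_at[OF this assms]
  have "((\<lambda>t. f (Complex x t)) has_vector_derivative \<i> * D) (at t)" by (simp add: o_def)
  then have "((\<lambda>t. Im (f (Complex x t))) has_vector_derivative Im (\<i> * D)) (at t)"
    by (rule bounded_linear.has_vector_derivative[OF bounded_linear_Im])
  then show ?thesis by (simp add: has_real_derivative_iff_has_vector_derivative)
qed

text \<open>The Noshiro-Warschawski criterion: along the segment from \<open>w\<close> in direction
  \<open>d\<close>, the function \<open>Re (cnj d * f)\<close> has derivative |d|^2
  \<open>Re f'\<close>, so it increases strictly and the endpoints cannot share a value.\<close>

lemma inj_on_Re_deriv_pos:
  fixes f :: "complex \<Rightarrow> complex"
  assumes "convex S"
    and f: "\<And>w. w \<in> S \<Longrightarrow> (f has_field_derivative f' w) (at w)"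
    and pos: "\<And>w. w \<in> S \<Longrightarrow> Re (f' w) > 0"
  shows "inj_on f S"
proof (rule inj_onI, rule ccontr)
  fix w z assume w: "w \<in> S" and z: "z \<in> S" and eq: "f w = f z" and ne: "w \<noteq> z"
  define d where "d = z - w"
  define r where "r = (\<lambda>t. Re (cnj d * f (w + of_real t * d)))"
  have "\<exists>y. (r has_real_derivative y) (at t) \<and> y > 0" if t: "0 \<le> t" "t \<le> 1" for t
  proof -
    define \<zeta> where "\<zeta> = w + of_real t * d"
    have "\<zeta> \<in> S"
      using convexD_alt[OF \<open>convex S\<close> w z t] by (simp add: \<zeta>_def d_def scaleR_conv_of_real algebra_simps)
    have "((\<lambda>t. w + of_real t * d) has_vector_derivative d) (at t)"
      by (auto intro!: derivative_eq_intros simp: has_vector_derivative_def scaleR_conv_of_real)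
    moreover have "((\<lambda>x. cnj d * f x) has_field_derivative cnj d * f' \<zeta>) (at (w + of_real t * d))"
      using DERIV_cmult[OF f[OF \<open>\<zeta> \<in> S\<close>], of "cnj d"] by (simp add: \<zeta>_def)
    ultimately have "((\<lambda>t. cnj d * f (w + of_real t * d)) has_vector_derivative d * (cnj d * f' \<zeta>)) (at t)"
      by (rule field_vector_diff_chain_at[unfolded o_def])
    then have "(r has_real_derivative Re (d * (cnj d * f' \<zeta>))) (at t)"
      unfolding r_def has_real_derivative_iff_has_vector_derivative by (rule bounded_linear.has_vector_derivative[OF bounded_linear_Re])
    moreover have "Re (d * (cnj d * f' \<zeta>)) > 0"
    proof -
      have "d * (cnj d * f' \<zeta>) = of_real ((cmod d)\<^sup>2) * f' \<zeta>"
        by (metis complex_norm_square mult.assoc)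
      moreover have "(cmod d)\<^sup>2 * Re (f' \<zeta>) > 0"
        using ne pos[OF \<open>\<zeta> \<in> S\<close>] by (simp add: d_def)
      ultimately show ?thesis by (simp only: scaleR_conv_of_real[symmetric] scaleR_complex.simps)
    qed
    ultimately show ?thesis by blast
  qed
  then have "r 0 < r 1" by (rule DERIV_pos_imp_increasing[OF zero_less_one])
  then show False using eq by (simp add: r_def d_def)
qed

text \<open>\<open>u - v\<close> is injective, and the preimage of a horizontal line under it is a graph over
  the interval \<open>(p, q)\<close>; along this curve \<open>Re (u + v)\<close> increases because
  \<open>(u' + v') / (u' - v')\<close> has positive real part.\<close>
lemma shear_of_strip:
  fixes p q :: real and u v u' v' :: "complex \<Rightarrow> complex"
  defines "S \<equiv> {w. p < Re w \<and> Re w < q}"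
  assumes u: "\<And>w. w \<in> S \<Longrightarrow> (u has_field_derivative u' w) (at w)"
    and v: "\<And>w. w \<in> S \<Longrightarrow> (v has_field_derivative v' w) (at w)"
    and lt: "\<And>w. w \<in> S \<Longrightarrow> cmod (v' w) < cmod (u' w)"
    and low: "\<And>x. p < x \<Longrightarrow> x < q \<Longrightarrow>
      \<exists>m>0. \<forall>t. m \<le> Re (u' (Complex x t) - v' (Complex x t))"
  shows "inj_on (\<lambda>w. u w + cnj (v w)) S"
    and "connected ((\<lambda>w. u w + cnj (v w)) ` S \<inter> {w. Im w = y})"
proof -
  let ?N = "\<lambda>w. u w + cnj (v w)"
  define \<Phi> where "\<Phi> = (\<lambda>w. u w - v w)"
  have S: "open S" "convex S"
  proof -
    have "S = {w. p < Re w} \<inter> {w. Re w < q}" by (auto simp: S_def)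
    then show "open S" "convex S"
      by (simp_all add: open_Int open_halfspace_Re_gt open_halfspace_Re_lt
          convex_Int convex_halfspace_Re_gt convex_halfspace_Re_lt)
  qed
  have d\<Phi>: "(\<Phi> has_field_derivative u' w - v' w) (at w)" if "w \<in> S" for w
    unfolding \<Phi>_def by (intro DERIV_diff u v that)
  have pos: "Re (u' w - v' w) > 0" if "w \<in> S" for w
    using low[of "Re w"] that unfolding S_def
    by (metis (mono_tags, lifting) complex_surj less_le_trans mem_Collect_eq)
  have hol\<Phi>: "\<Phi> holomorphic_on S"
    using d\<Phi> S by (auto simp: holomorphic_on_open)
  have inj\<Phi>: "inj_on \<Phi> S"
    by (rule inj_on_Re_deriv_pos[OF S(2) d\<Phi> pos])
  have cont: "continuous_on S u" "continuous_on S v" 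
    using u v by (auto intro!: continuous_at_imp_continuous_on DERIV_isCont)
  \<comment> \<open>Linear growth on vertical lines gives both strict monotonicity and surjectivity
    of \<open>Im \<Phi>\<close> there; bare positivity of the derivative would not give the
    latter.\<close>
  have growth: "Im (\<Phi> (Complex x s)) + m * (t - s) \<le> Im (\<Phi> (Complex x t))"
    if x: "p < x" "x < q" and m: "\<And>t. m \<le> Re (u' (Complex x t) - v' (Complex x t))" and "s \<le> t"
    for x s t m
  proof -
    have "Im (\<Phi> (Complex x s)) - m * s \<le> Im (\<Phi> (Complex x t)) - m * t"
    proof (rule DERIV_nonneg_imp_nondecreasing[OF \<open>s \<le> t\<close>], intro exI conjI)
      fix r
      show "((\<lambda>t. Im (\<Phi> (Complex x t)) - m * t) has_real_derivative
          Re (u' (Complex x r) - v' (Complex x r)) - m * 1) (at r)"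
        using x by (intro DERIV_diff vertical_DERIV_Im d\<Phi> DERIV_cmult DERIV_ident) (simp add: S_def)
      show "0 \<le> Re (u' (Complex x r) - v' (Complex x r)) - m * 1" using m[of r] by simp
    qed
    then show ?thesis by (simp add: algebra_simps)
  qed
  have level: "connected {w. p < Re w \<and> Re w < q \<and> Im (\<Phi> w) = y}" for y
  proof (rule connected_level_set_strip)
    show "continuous_on {w. p < Re w \<and> Re w < q} (\<lambda>w. Im (\<Phi> w))"
      using cont unfolding S_def \<Phi>_def by (intro continuous_intros)
  next
    fix x s t :: real assume x: "p < x" "x < q" and "s < t"
    obtain m where "m > 0" and m: "\<And>t. m \<le> Re (u' (Complex x t) - v' (Complex x t))"
      using low[OF x] by auto
    have "m * (t - s) > 0" using \<open>m > 0\<close> \<open>s < t\<close> by simp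
    then show "Im (\<Phi> (Complex x s)) < Im (\<Phi> (Complex x t))"
      using growth[OF x m, of s t] \<open>s < t\<close> by simp
  next
    fix x assume x: "p < x" "x < q"
    obtain m where "m > 0" and m: "\<And>t. m \<le> Re (u' (Complex x t) - v' (Complex x t))"
      using low[OF x] by auto
    \<comment> \<open>At rate at least \<open>m\<close>, a height change of \<open>T\<close> covers
      the gap between \<open>y\<close> and the value at height \<open>0\<close>, in either
      direction.\<close>
    define T where "T = \<bar>y - Im (\<Phi> (Complex x 0))\<bar> / m"
    have T: "T \<ge> 0" "m * T = \<bar>y - Im (\<Phi> (Complex x 0))\<bar>" using \<open>m > 0\<close> by (auto simp: T_def)
    have "\<exists>t\<ge>-T. t \<le> T \<and> Im (\<Phi> (Complex x t)) = y"
    proof (rule IVT')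
      show "Im (\<Phi> (Complex x (-T))) \<le> y" "y \<le> Im (\<Phi> (Complex x T))" "- T \<le> T"
        using growth[OF x m, of "-T" 0] growth[OF x m, of 0 T] T by auto
      show "continuous_on {-T..T} (\<lambda>t. Im (\<Phi> (Complex x t)))"
        using vertical_DERIV_Im[OF d\<Phi>] x
        by (intro continuous_at_imp_continuous_on ballI) (fastforce simp: S_def intro: DERIV_isCont)
    qed
    then show "\<exists>t. Im (\<Phi> (Complex x t)) = y" by auto
  qed
  \<comment> \<open>The holomorphic inverse of \<Phi> parametrizes a level curve of
    \<open>Im \<Phi>\<close> by the value of \<open>Re \<Phi>\<close>.\<close>
  obtain \<Psi> where \<Psi>: "\<Psi> holomorphic_on (\<Phi> ` S)" "\<And>w. w \<in> S \<Longrightarrow> deriv \<Phi> w * deriv \<Psi> (\<Phi> w) = 1"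
    "\<And>w. w \<in> S \<Longrightarrow> \<Psi> (\<Phi> w) = w"
    using holomorphic_has_inverse[OF hol\<Phi> S(1) inj\<Phi>] by blast
  have open\<Phi>: "open (\<Phi> ` S)"
    using open_mapping_thm3[OF hol\<Phi> S(1) inj\<Phi>] .
  have Re_mono: "Re (?N w) < Re (?N z)"
    if w: "w \<in> S" and z: "z \<in> S" and Im_eq: "Im (\<Phi> w) = Im (\<Phi> z)" and less: "Re (\<Phi> w) < Re (\<Phi> z)" for w z
  proof -
    define y where "y = Im (\<Phi> z)"
    have "connected ((\<lambda>w. Re (\<Phi> w)) ` {w. p < Re w \<and> Re w < q \<and> Im (\<Phi> w) = y})" (is "connected ?R")
    proof (rule connected_continuous_image[OF _ level])
      show "continuous_on {w. p < Re w \<and> Re w < q \<and> Im (\<Phi> w) = y} (\<lambda>w. Re (\<Phi> w))"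
        unfolding \<Phi>_def
        by (intro continuous_intros) (auto intro: continuous_on_subset[OF cont(1)] continuous_on_subset[OF cont(2)] simp: S_def)
    qed
    moreover have "Re (\<Phi> w) \<in> ?R" "Re (\<Phi> z) \<in> ?R"
      using w z Im_eq by (auto simp: S_def y_def)
    \<comment> \<open>A connected set of reals contains the interval between any two of its points,
      so the whole horizontal segment from \<open>\<Phi> w\<close> to \<open>\<Phi> z\<close> lies
      in the image of \<Phi>.\<close>
    ultimately have seg: "{Re (\<Phi> w)..Re (\<Phi> z)} \<subseteq> ?R"
      by (rule connected_contains_Icc)
    define r where "r = (\<lambda>\<xi>. Re ((u (\<Psi> (Complex \<xi> y)) + v (\<Psi> (Complex \<xi> y)))))"
    have deriv_pos: "\<exists>l. (r has_real_derivative l) (at \<xi>) \<and> l > 0" if \<xi>: "Re (\<Phi> w) \<le> \<xi>" "\<xi> \<le> Re (\<Phi> z)" for \<xi>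
    proof -
      obtain \<zeta> where \<zeta>: "\<zeta> \<in> S" "Complex \<xi> y = \<Phi> \<zeta>"
        using seg \<xi> by (force simp: S_def complex_eq_iff)
      have "((\<lambda>\<xi>. Complex \<xi> y) has_vector_derivative 1) (at \<xi>)"
        unfolding Complex_eq by (auto intro!: derivative_eq_intros simp: has_vector_derivative_def scaleR_conv_of_real)
      moreover have "(\<Psi> has_field_derivative inverse (u' \<zeta> - v' \<zeta>)) (at (Complex \<xi> y))"
      proof -
        have "(\<Psi> has_field_derivative deriv \<Psi> (\<Phi> \<zeta>)) (at (\<Phi> \<zeta>))"
          using \<Psi>(1) open\<Phi> \<zeta>(1) by (auto intro: holomorphic_derivI)
        moreover have "deriv \<Psi> (\<Phi> \<zeta>) = inverse (u' \<zeta> - v' \<zeta>)"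
          using \<Psi>(2)[OF \<zeta>(1)] DERIV_imp_deriv[OF d\<Phi>[OF \<zeta>(1)]] by (metis inverse_unique)
        ultimately show ?thesis using \<zeta>(2) by simp
      qed
      moreover have "((\<lambda>w. u w + v w) has_field_derivative u' \<zeta> + v' \<zeta>) (at (\<Psi> (Complex \<xi> y)))"
        unfolding \<zeta>(2) \<Psi>(3)[OF \<zeta>(1)] by (intro DERIV_add u v \<zeta>(1))
      ultimately have "((\<lambda>\<xi>. u (\<Psi> (Complex \<xi> y)) + v (\<Psi> (Complex \<xi> y))) has_vector_derivative
          1 * ((u' \<zeta> + v' \<zeta>) * inverse (u' \<zeta> - v' \<zeta>))) (at \<xi>)"
        by (intro field_vector_diff_chain_at[unfolded o_def, where g = "\<lambda>z. u (\<Psi> z) + v (\<Psi> z)"]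
            DERIV_chain2[where f = "\<lambda>w. u w + v w"])
      then have "(r has_real_derivative Re ((u' \<zeta> + v' \<zeta>) / (u' \<zeta> - v' \<zeta>))) (at \<xi>)"
        unfolding r_def has_real_derivative_iff_has_vector_derivative
        by (intro bounded_linear.has_vector_derivative[OF bounded_linear_Re]) (simp add: divide_inverse)
      moreover have "Re ((u' \<zeta> + v' \<zeta>) / (u' \<zeta> - v' \<zeta>)) > 0"
      proof -
        have ne: "u' \<zeta> \<noteq> 0" using lt[OF \<zeta>(1)] by auto
        have "u' \<zeta> - v' \<zeta> \<noteq> 0" using pos[OF \<zeta>(1)] by auto
        \<comment> \<open>This is a Cayley transform of \<open>- v' \<zeta> / u' \<zeta>\<close>,
          whose modulus is below \<open>1\<close>.\<close>
        then have "(u' \<zeta> + v' \<zeta>) / (u' \<zeta> - v' \<zeta>) = (1 - (- v' \<zeta> / u' \<zeta>)) / (1 + (- v' \<zeta> / u' \<zeta>))"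
          using ne by (simp add: divide_simps)
        then show ?thesis
          using Re_cayley_pos[of "- v' \<zeta> / u' \<zeta>"] lt[OF \<zeta>(1)] ne by (simp add: norm_divide)
      qed
      ultimately show ?thesis by blast
    qed
    have "r (Re (\<Phi> w)) < r (Re (\<Phi> z))"
      by (rule DERIV_pos_imp_increasing[OF less deriv_pos])
    moreover have "Complex (Re (\<Phi> w)) y = \<Phi> w" "Complex (Re (\<Phi> z)) y = \<Phi> z"
      using Im_eq by (simp_all add: y_def complex_eq_iff)
    ultimately show ?thesis using w z by (simp add: r_def \<Psi>(3))
  qed
  \<comment> \<open>Conjugating \<open>v\<close> turns its sign in the imaginary part only:
    \<open>Im\<close> sees \<open>u - v\<close> and \<open>Re\<close> sees
    \<open>u + v\<close>.\<close>
  have Im_N: "Im (?N w) = Im (\<Phi> w)" for w by (simp add: \<Phi>_def)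
  show "inj_on ?N S"
  proof (rule inj_onI)
    fix w z assume w: "w \<in> S" and z: "z \<in> S" and eq: "?N w = ?N z"
    have Im_eq: "Im (\<Phi> w) = Im (\<Phi> z)" using eq Im_N by metis
    have "Re (\<Phi> w) = Re (\<Phi> z)"
      using Re_mono[OF w z] Re_mono[OF z w] Im_eq eq by (metis less_irrefl linorder_neqE)
    with Im_eq have "\<Phi> w = \<Phi> z" by (simp add: complex_eq_iff)
    then show "w = z" using inj\<Phi> w z by (meson inj_onD)
  qed
  have "connected (?N ` {w. p < Re w \<and> Re w < q \<and> Im (\<Phi> w) = y})"
    by (rule connected_continuous_image[OF _ level])
       (intro continuous_intros, auto intro: continuous_on_subset[OF cont(1)] continuous_on_subset[OF cont(2)] simp: S_def)
  moreover have "?N ` {w. p < Re w \<and> Re w < q \<and> Im (\<Phi> w) = y} = ?N ` S \<inter> {w. Im w = y}"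
    unfolding S_def \<Phi>_def by force
  ultimately show "connected (?N ` S \<inter> {w. Im w = y})" by simp
qed

section \<open>The conformal map of the strip onto the disc\<close>

text \<open>The inverse of the conformal map \<open>h + g\<close> of the disc onto the strip.\<close>
definition strip_to_disc :: "real \<Rightarrow> complex \<Rightarrow> complex" where
  "strip_to_disc \<beta> w = sin (of_real (sin \<beta>) * w) / sin (of_real \<beta> - of_real (sin \<beta>) * w)"

lemma vertical_strip_scaled:
  assumes "0 < \<beta>" "\<beta> < pi" "w \<in> vertical_strip \<beta>"
  shows "(\<beta> - pi) / 2 < sin \<beta> * Re w" "sin \<beta> * Re w < \<beta> / 2"
proof -
  have "sin \<beta> > 0" using assms by (simp add: sin_gt_zero)
  then show "(\<beta> - pi) / 2 < sin \<beta> * Re w" "sin \<beta> * Re w < \<beta> / 2"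
    using assms(3) by (simp_all add: vertical_strip_def field_simps)
qed

text \<open>The squared modulus of the sine depends evenly on the imaginary part and otherwise only
  on the cosine of twice the real part. Since \<open>x\<close> and \<beta> - \<open>x\<close> have
  opposite imaginary parts, only the cosines matter; they differ by
  \<open>2 * (sin \<beta> * sin (\<beta> - 2 * Re x))\<close>.\<close>

lemma norm_sin_less_norm_sin_reflect:
  assumes \<beta>: "0 < \<beta>" "\<beta> < pi" and x: "(\<beta> - pi) / 2 < Re x" "Re x < \<beta> / 2"
  shows "cmod (sin x) < cmod (sin (of_real \<beta> - x))"
proof -
  have "sin \<beta> * sin (\<beta> - 2 * Re x) > 0"
    using \<beta> x by (intro mult_pos_pos sin_gt_zero) auto
  then have "cos (2 * Re (of_real \<beta> - x)) < cos (2 * Re x)"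
  proof -
    have "(2 * Re x + 2 * Re (of_real \<beta> - x)) / 2 = \<beta>"
      and "(2 * Re (of_real \<beta> - x) - 2 * Re x) / 2 = \<beta> - 2 * Re x"
      by (simp_all add: field_simps)
    with cos_diff_cos[of "2 * Re x" "2 * Re (of_real \<beta> - x)"]
    have "cos (2 * Re x) - cos (2 * Re (of_real \<beta> - x)) = 2 * (sin \<beta> * sin (\<beta> - 2 * Re x))"
      by (simp only: mult.assoc)
    then show ?thesis using \<open>sin \<beta> * sin (\<beta> - 2 * Re x) > 0\<close> by linarith
  qed
  then have "(cmod (sin x))\<^sup>2 < (cmod (sin (of_real \<beta> - x)))\<^sup>2"
    unfolding norm_sin_squared by (simp add: exp_minus)
  then show ?thesis by (rule power2_less_imp_less) simp
qed

lemma sin_reflect_nonzero: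
  assumes "0 < \<beta>" "\<beta> < pi" "w \<in> vertical_strip \<beta>"
  shows "sin (of_real \<beta> - of_real (sin \<beta>) * w) \<noteq> 0"
  using norm_sin_less_norm_sin_reflect[of \<beta> "of_real (sin \<beta>) * w"] vertical_strip_scaled[OF assms] assms
  by auto

lemma norm_strip_to_disc_less_1:
  assumes "0 < \<beta>" "\<beta> < pi" "w \<in> vertical_strip \<beta>"
  shows "cmod (strip_to_disc \<beta> w) < 1"
  using norm_sin_less_norm_sin_reflect[of \<beta> "of_real (sin \<beta>) * w"] vertical_strip_scaled[OF assms] assms
    sin_reflect_nonzero[OF assms]
  by (simp add: strip_to_disc_def norm_divide)

text \<open>Cross-multiplying equal values reduces to \<open>sin (x - y) = 0\<close> for the scaled
  points. The scaled strip has width \<open>pi / 2\<close>, so the multiple of \<open>pi\<close>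
  separating them is \<open>0\<close>.\<close>

lemma inj_on_strip_to_disc:
  assumes \<beta>: "0 < \<beta>" "\<beta> < pi"
  shows "inj_on (strip_to_disc \<beta>) (vertical_strip \<beta>)"
proof (rule inj_onI)
  fix w z assume w: "w \<in> vertical_strip \<beta>" and z: "z \<in> vertical_strip \<beta>"
    and eq: "strip_to_disc \<beta> w = strip_to_disc \<beta> z"
  define x y where "x = of_real (sin \<beta>) * w" and "y = of_real (sin \<beta>) * z"
  have s: "sin \<beta> > 0" using \<beta> by (simp add: sin_gt_zero)
  have "sin x * sin (of_real \<beta> - y) = sin y * sin (of_real \<beta> - x)"
    using eq sin_reflect_nonzero[OF \<beta> w] sin_reflect_nonzero[OF \<beta> z]
    by (simp add: strip_to_disc_def x_def y_def field_simps)
  then have "sin (of_real \<beta>) * sin (x - y) = 0"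
    by (simp add: sin_diff algebra_simps)
  then have "sin (x - y) = 0" using s by (simp add: sin_of_real)
  then obtain m :: int where m: "x - y = of_real (m * pi)" by (auto simp: sin_eq_0)
  have "\<bar>Re (x - y)\<bar> < pi / 2"
    using vertical_strip_scaled[OF \<beta> w] vertical_strip_scaled[OF \<beta> z]
    unfolding x_def y_def abs_less_iff by auto
  then have "\<bar>of_int m * pi\<bar> < 1 * pi" using m by simp
  then have "\<bar>of_int m :: real\<bar> < 1" by (simp add: abs_mult)
  then have "m = 0" by linarith
  then have "x = y" using m by simp
  then show "w = z" using s by (simp add: x_def y_def)
qed

lemma strip_to_disc_deriv:
  assumes \<beta>: "0 < \<beta>" "\<beta> < pi" and w: "w \<in> vertical_strip \<beta>"
  shows "(strip_to_disc \<beta> has_field_derivative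
    (of_real (sin \<beta>))\<^sup>2 / (sin (of_real \<beta> - of_real (sin \<beta>) * w))\<^sup>2) (at w)"
proof -
  define s :: complex where "s = of_real (sin \<beta>)"
  have ne: "sin (of_real \<beta> - s * w) \<noteq> 0"
    using sin_reflect_nonzero[OF assms] by (simp add: s_def)
  \<comment> \<open>The addition formula for \<beta> split this way collapses the numerator of the
    quotient rule.\<close>
  have "s = sin ((of_real \<beta> - s * w) + s * w)" by (simp add: s_def sin_of_real)
  then have e: "s = sin (of_real \<beta> - s * w) * cos (s * w) + cos (of_real \<beta> - s * w) * sin (s * w)"
    by (simp only: sin_add)
  have "((\<lambda>w. sin (s * w) / sin (of_real \<beta> - s * w)) has_field_derivative
      (s * cos (s * w) * sin (of_real \<beta> - s * w) - sin (s * w) * (- s * cos (of_real \<beta> - s * w)))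
      / (sin (of_real \<beta> - s * w))\<^sup>2) (at w)"
    using ne by (auto intro!: derivative_eq_intros simp: power2_eq_square mult_ac)
  also have "s * cos (s * w) * sin (of_real \<beta> - s * w) - sin (s * w) * (- s * cos (of_real \<beta> - s * w))
      = s * (sin (of_real \<beta> - s * w) * cos (s * w) + cos (of_real \<beta> - s * w) * sin (s * w))"
    by (simp add: algebra_simps)
  also have "\<dots> = s\<^sup>2" unfolding e[symmetric] by (simp add: power2_eq_square)
  finally show ?thesis by (simp add: strip_to_disc_def[abs_def] s_def)
qed

text \<open>The quotient of \<^const>\<open>strip_to_disc\<close> by its derivative: in the strip coordinate the operator
  \<open>z d/dz\<close> becomes \<open>strip_log_scale \<beta> w d/dw\<close>.\<close>
definition strip_log_scale :: "real \<Rightarrow> complex \<Rightarrow> complex" where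
  "strip_log_scale \<beta> w = sin (of_real (sin \<beta>) * w) * sin (of_real \<beta> - of_real (sin \<beta>) * w) / (of_real (sin \<beta>))\<^sup>2"

lemma strip_log_scale_mult_deriv:
  assumes \<beta>: "0 < \<beta>" "\<beta> < pi" and w: "w \<in> vertical_strip \<beta>"
  shows "strip_log_scale \<beta> w * ((of_real (sin \<beta>))\<^sup>2 / (sin (of_real \<beta> - of_real (sin \<beta>) * w))\<^sup>2)
    = strip_to_disc \<beta> w"
proof -
  have "sin \<beta> > 0" using \<beta> by (simp add: sin_gt_zero)
  then show ?thesis
    using sin_reflect_nonzero[OF assms]
    by (simp add: strip_log_scale_def strip_to_disc_def power2_eq_square)
qed

lemma strip_log_scale_deriv:
  assumes \<beta>: "0 < \<beta>" "\<beta> < pi"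
  shows "(strip_log_scale \<beta> has_field_derivative
    sin (of_real \<beta> - 2 * of_real (sin \<beta>) * w) / of_real (sin \<beta>)) (at w)"
proof -
  define s :: complex where "s = of_real (sin \<beta>)"
  have "sin \<beta> > 0" using \<beta> by (simp add: sin_gt_zero)
  then have s: "s \<noteq> 0" by (simp add: s_def)
  have "((\<lambda>w. sin (s * w) * sin (of_real \<beta> - s * w) / s\<^sup>2) has_field_derivative
      (s * cos (s * w) * sin (of_real \<beta> - s * w) + - s * cos (of_real \<beta> - s * w) * sin (s * w)) / s\<^sup>2) (at w)"
    by (intro DERIV_cdivide) (auto intro!: derivative_eq_intros simp: algebra_simps)
  also have "(s * cos (s * w) * sin (of_real \<beta> - s * w) + - s * cos (of_real \<beta> - s * w) * sin (s * w)) / s\<^sup>2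
     = (sin (of_real \<beta> - s * w) * cos (s * w) - cos (of_real \<beta> - s * w) * sin (s * w)) / s"
    using s by (simp add: power2_eq_square divide_simps) (simp add: algebra_simps)
  also have "\<dots> = sin (of_real \<beta> - 2 * s * w) / s"
    unfolding sin_diff[symmetric] by (simp add: algebra_simps)
  finally show ?thesis by (simp add: strip_log_scale_def[abs_def] s_def)
qed

text \<open>The real part of the sine is the sine of the real part times a hyperbolic cosine, which
  is at least \<open>1\<close>. The bound depends on \<open>Re w\<close> alone, so it is uniform on
  each vertical line, as \<open>shear_of_strip\<close> demands.\<close>

lemma Re_strip_log_scale_deriv_ge:
  assumes \<beta>: "0 < \<beta>" "\<beta> < pi" and w: "w \<in> vertical_strip \<beta>"
  shows "Re (sin (of_real \<beta> - 2 * of_real (sin \<beta>) * w) / of_real (sin \<beta>))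
      \<ge> sin (\<beta> - 2 * (sin \<beta> * Re w)) / sin \<beta>"
    and "sin (\<beta> - 2 * (sin \<beta> * Re w)) / sin \<beta> > 0"
proof -
  have s: "sin \<beta> > 0" using \<beta> by (simp add: sin_gt_zero)
  have p: "sin (\<beta> - 2 * (sin \<beta> * Re w)) > 0"
    using vertical_strip_scaled[OF assms] \<beta> by (intro sin_gt_zero) auto
  then show "sin (\<beta> - 2 * (sin \<beta> * Re w)) / sin \<beta> > 0" using s by simp
  have cosh_ge: "exp t + exp (- t) \<ge> 2" for t :: real
    using cosh_real_ge_1[of t] by (simp add: cosh_def)
  define t where "t = Im (of_real \<beta> - 2 * of_real (sin \<beta>) * w)"
  have "Re (sin (of_real \<beta> - 2 * of_real (sin \<beta>) * w))
      = sin (\<beta> - 2 * (sin \<beta> * Re w)) * ((exp t + exp (- t)) / 2)"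
    by (simp add: Re_sin t_def mult.assoc)
  moreover have "\<dots> \<ge> sin (\<beta> - 2 * (sin \<beta> * Re w)) * 1"
    using p cosh_ge[of t] by (intro mult_left_mono) auto
  ultimately show "Re (sin (of_real \<beta> - 2 * of_real (sin \<beta>) * w) / of_real (sin \<beta>))
      \<ge> sin (\<beta> - 2 * (sin \<beta> * Re w)) / sin \<beta>"
    using s by (simp add: divide_right_mono)
qed

text \<open>The equality case of the Schwarz lemma identifies \<open>k\<close>, so the explicit formula
  for \<open>h + g\<close> is not an assumption.\<close>
lemma strip_to_disc_inverse:
  assumes \<beta>: "0 < \<beta>" "\<beta> < pi"
    and k: "k holomorphic_on unit_disc" "k 0 = 0" "deriv k 0 = 1" "k ` unit_disc \<subseteq> vertical_strip \<beta>"
    and z: "z \<in> unit_disc"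
  shows "strip_to_disc \<beta> (k z) = z"
proof -
  let ?f = "\<lambda>z. strip_to_disc \<beta> (k z)"
  have d: "(?f has_field_derivative (of_real (sin \<beta>))\<^sup>2 /
      (sin (of_real \<beta> - of_real (sin \<beta>) * k z))\<^sup>2 * deriv k z) (at z)"
    if "z \<in> unit_disc" for z
    using k that by (intro DERIV_chain2[OF strip_to_disc_deriv[OF \<beta>]] holomorphic_derivI[OF k(1)]) auto
  have s: "sin \<beta> > 0" using \<beta> by (simp add: sin_gt_zero)
  have hol: "?f holomorphic_on unit_disc"
    unfolding holomorphic_on_open[OF open_ball] using d by blast
  have f0: "?f 0 = 0" using k(2) by (simp add: strip_to_disc_def)
  have bound: "cmod (?f z) < 1" if "cmod z < 1" for z
    using k(4) that by (intro norm_strip_to_disc_less_1[OF \<beta>]) (auto simp: image_subset_iff)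
  \<comment> \<open>At \<open>0\<close> both derivatives in the chain rule are \<open>1\<close>, so
    equality holds in the Schwarz bound.\<close>
  have d0: "deriv ?f 0 = 1"
    using d[of 0, THEN DERIV_imp_deriv] k(2,3) s by (simp add: sin_of_real)
  then have "cmod (deriv ?f 0) = 1" by simp
  then obtain \<alpha> where \<alpha>: "\<And>z. cmod z < 1 \<Longrightarrow> ?f z = \<alpha> * z"
    using Schwarz_Lemma(3)[OF hol f0 bound, of 0] by auto
  \<comment> \<open>The Schwarz lemma yields only a rotation; its factor is read off from the
    derivative at \<open>0\<close>.\<close>
  have "deriv ?f 0 = \<alpha>"
  proof (rule DERIV_imp_deriv)
    have "((\<lambda>z. \<alpha> * z) has_field_derivative \<alpha>) (at 0)"
      by (auto intro!: derivative_eq_intros)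
    then show "(?f has_field_derivative \<alpha>) (at 0)"
      by (rule has_field_derivative_transform_within_open[of _ _ _ unit_disc]) (auto simp: \<alpha>)
  qed
  then show ?thesis using \<alpha>[of z] z d0 by simp
qed

section \<open>The convolution in the strip coordinate\<close>

text \<open>Here \<open>x\<close>, \<open>D\<close>, \<open>\<kappa>\<close> and \<open>K\<close>
  stand for \<omega>, \<omega>', the scale \<kappa> and \<kappa>' at one point; the left sides come
  from the product rule. With \<open>E = 1 / (1 + x)\<close> one has \<open>x * E = 1 - E\<close>,
  and all terms become polynomials in \<open>E\<close>.\<close>

lemma shear_derivatives_identity:
  fixes x D \<kappa> K :: complex and b :: real and n :: nat
  assumes x: "1 + x \<noteq> 0" and D: "\<kappa> * D = of_nat n * x"
  defines "Y \<equiv> of_real b * K + of_real (b * n / 2) * ((1 - x) / (1 + x))"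
    and "c \<equiv> of_real (1 - b - b * n / 2)"
  shows "of_real (1 - b) * (1 / (1 + x)) + of_real b * (K * (1 / (1 + x)) + - (D / (1 + x)\<^sup>2) * \<kappa>)
      = 1 / (1 + x) * (c + Y)"
    and "of_real (1 - b) * (x / (1 + x)) - of_real b * (K * (x / (1 + x)) + D / (1 + x)\<^sup>2 * \<kappa>)
      = x / (1 + x) * (c - Y)"
proof -
  define E where "E = 1 / (1 + x)"
  have E: "E + x * E = 1" using x by (simp add: E_def field_simps)
  have 1: "D / (1 + x)\<^sup>2 * \<kappa> = of_nat n * x * E * E"
  proof -
    have "D / (1 + x)\<^sup>2 * \<kappa> = \<kappa> * D * E * E"
      by (simp add: E_def power2_eq_square)
    then show ?thesis using D by simp
  qed
  have 2: "x / (1 + x) = x * E" "1 / (1 + x) = E" "(1 - x) / (1 + x) = E - x * E"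
    by (simp_all add: E_def diff_divide_distrib)
  have E': "x * E = 1 - E" using E by (simp add: algebra_simps)
  have 3: "of_nat n * x * E * E = of_nat n * (1 - E) * E"
    using E' by (simp add: mult.assoc)
  show "of_real (1 - b) * (1 / (1 + x)) + of_real b * (K * (1 / (1 + x)) + - (D / (1 + x)\<^sup>2) * \<kappa>)
      = 1 / (1 + x) * (c + Y)"
    unfolding mult_minus_left 1 2 3 Y_def c_def E' by (simp add: field_simps)
  show "of_real (1 - b) * (x / (1 + x)) - of_real b * (K * (x / (1 + x)) + D / (1 + x)\<^sup>2 * \<kappa>)
      = x / (1 + x) * (c - Y)"
    unfolding 1 2 3 Y_def c_def E' by (simp add: field_simps)
qed

text \<open>\<open>U\<close> and \<open>V\<close> stand for the analytic parts of the strip mapping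
  in the coordinate \<open>w\<close>, and
  \<open>strip_log_scale \<beta> w / (1 + \<omega> w)\<close> for z h'(z). The bound on
  \<open>b\<close> is the nonnegativity of \<open>c\<close> below.\<close>

lemma strip_convolution_shear:
  fixes U V :: "complex \<Rightarrow> complex" and b \<theta> y :: real and n :: nat
  assumes \<beta>: "0 < \<beta>" "\<beta> < pi" and b: "0 < b" "b + b * n / 2 \<le> 1"
  defines "\<omega> \<equiv> \<lambda>w. cis \<theta> * strip_to_disc \<beta> w ^ n"
  assumes n: "n \<ge> 1"
    and U: "\<And>w. w \<in> vertical_strip \<beta> \<Longrightarrow> (U has_field_derivative 1 / (1 + \<omega> w)) (at w)"
    and V: "\<And>w. w \<in> vertical_strip \<beta> \<Longrightarrow> (V has_field_derivative \<omega> w / (1 + \<omega> w)) (at w)"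
  defines "N \<equiv> \<lambda>w. of_real (1 - b) * U w + of_real b * (strip_log_scale \<beta> w * (1 / (1 + \<omega> w)))
    + cnj (of_real (1 - b) * V w - of_real b * (strip_log_scale \<beta> w * (\<omega> w / (1 + \<omega> w))))"
  shows "inj_on N (vertical_strip \<beta>)" "connected (N ` vertical_strip \<beta> \<inter> {w. Im w = y})"
proof -
  define K where "K w = sin (of_real \<beta> - 2 * of_real (sin \<beta>) * w) / of_real (sin \<beta>)" for w :: complex
  define Y where "Y w = of_real b * K w + of_real (b * n / 2) * ((1 - \<omega> w) / (1 + \<omega> w))" for w
  \<comment> \<open>With \<open>Re (Y w) > 0\<close> and \<open>c \<ge> 0\<close>, the factorization of \<open>u'\<close> and \<open>v'\<close> gives \<open>|v'| < |u'|\<close>.\<close>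
  define c where "c = 1 - b - b * n / 2"
  define u' where "u' w = 1 / (1 + \<omega> w) * (of_real c + Y w)" for w
  define v' where "v' w = \<omega> w / (1 + \<omega> w) * (of_real c - Y w)" for w
  have c: "c \<ge> 0" using b by (simp add: c_def)
  \<comment> \<open>The strict bound uses \<open>n \<ge> 1\<close>: a zeroth power would leave
    modulus \<open>1\<close>.\<close>
  have norm\<omega>: "cmod (\<omega> w) < 1" if "w \<in> vertical_strip \<beta>" for w
    using norm_strip_to_disc_less_1[OF \<beta> that] n
    by (simp add: \<omega>_def norm_mult norm_power power_less_one_iff)
  have ne: "1 + \<omega> w \<noteq> 0" if "w \<in> vertical_strip \<beta>" for w
  proof
    assume "1 + \<omega> w = 0"
    then have "\<omega> w = -1" by (simp add: eq_neg_iff_add_eq_0 add.commute)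
    then show False using norm\<omega>[OF that] by simp
  qed
  have derivs: "((\<lambda>w. of_real (1 - b) * U w + of_real b * (strip_log_scale \<beta> w * (1 / (1 + \<omega> w))))
        has_field_derivative u' w) (at w)"
    "((\<lambda>w. of_real (1 - b) * V w - of_real b * (strip_log_scale \<beta> w * (\<omega> w / (1 + \<omega> w))))
        has_field_derivative v' w) (at w)" if w: "w \<in> vertical_strip \<beta>" for w
  proof -
    define Z' where "Z' = (of_real (sin \<beta>))\<^sup>2 / (sin (of_real \<beta> - of_real (sin \<beta>) * w))\<^sup>2"
    define D where "D = cis \<theta> * (of_nat n * (Z' * strip_to_disc \<beta> w ^ (n - 1)))"
    have \<omega>': "(\<omega> has_field_derivative D) (at w)"
      unfolding \<omega>_def D_def Z'_def
      using DERIV_cmult[OF DERIV_power[OF strip_to_disc_deriv[OF \<beta> w]]] by simp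
    \<comment> \<open>Multiplication by \<kappa> followed by d/dw acts as the Euler operator in Z,
      under which the monomial \<omega> is an eigenfunction with eigenvalue
      \<open>n\<close>.\<close>
    have "strip_log_scale \<beta> w * D
        = cis \<theta> * of_nat n * ((strip_log_scale \<beta> w * Z') * strip_to_disc \<beta> w ^ (n - 1))"
      by (simp add: D_def)
    also have "strip_log_scale \<beta> w * Z' = strip_to_disc \<beta> w"
      unfolding Z'_def by (rule strip_log_scale_mult_deriv[OF \<beta> w])
    also have "strip_to_disc \<beta> w * strip_to_disc \<beta> w ^ (n - 1) = strip_to_disc \<beta> w ^ n"
      using n by (cases n) auto
    finally have D: "strip_log_scale \<beta> w * D = of_nat n * \<omega> w" by (simp add: \<omega>_def)
    have \<kappa>: "(strip_log_scale \<beta> has_field_derivative K w) (at w)"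
      unfolding K_def by (rule strip_log_scale_deriv[OF \<beta>])
    have r1: "((\<lambda>w. 1 / (1 + \<omega> w)) has_field_derivative - (D / (1 + \<omega> w)\<^sup>2)) (at w)"
      using ne[OF w] by (auto intro!: derivative_eq_intros \<omega>' simp: power2_eq_square)
    have r2: "((\<lambda>w. \<omega> w / (1 + \<omega> w)) has_field_derivative D / (1 + \<omega> w)\<^sup>2) (at w)"
      using ne[OF w] by (auto intro!: derivative_eq_intros \<omega>' simp: power2_eq_square divide_simps algebra_simps)
    note id = shear_derivatives_identity[OF ne[OF w] D, of b "K w", folded Y_def c_def, folded u'_def v'_def]
    show "((\<lambda>w. of_real (1 - b) * U w + of_real b * (strip_log_scale \<beta> w * (1 / (1 + \<omega> w))))
        has_field_derivative u' w) (at w)"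
      unfolding id(1)[symmetric]
      by (intro DERIV_add DERIV_cmult DERIV_mult U[OF w] \<kappa> r1)
    show "((\<lambda>w. of_real (1 - b) * V w - of_real b * (strip_log_scale \<beta> w * (\<omega> w / (1 + \<omega> w))))
        has_field_derivative v' w) (at w)"
      unfolding id(2)[symmetric]
      by (intro DERIV_diff DERIV_cmult DERIV_mult V[OF w] \<kappa> r2)
  qed
  have ReY: "Re (Y w) > 0" and Re_diff: "Re (u' w - v' w) \<ge> b * (sin (\<beta> - 2 * (sin \<beta> * Re w)) / sin \<beta>)"
    if w: "w \<in> vertical_strip \<beta>" for w
  proof -
    define Q where "Q = (1 - \<omega> w) / (1 + \<omega> w)"
    have Q: "Re Q > 0" unfolding Q_def by (rule Re_cayley_pos[OF norm\<omega>[OF w]])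
    note K = Re_strip_log_scale_deriv_ge[OF \<beta> w, folded K_def]
    have bK: "b * (sin (\<beta> - 2 * (sin \<beta> * Re w)) / sin \<beta>) \<le> b * Re (K w)"
      using K(1) b by (intro mult_left_mono) auto
    have "b * Re (K w) > 0" using K b by (intro mult_pos_pos) auto
    moreover have "b * n / 2 * Re Q \<ge> 0" using b Q by (intro mult_nonneg_nonneg) auto
    moreover have Y: "Re (Y w) = b * Re (K w) + b * n / 2 * Re Q"
    proof -
      have "Re (of_real r * z) = r * Re z" for r z by simp
      then show ?thesis by (simp only: Y_def Q_def plus_complex.sel)
    qed
    ultimately show "Re (Y w) > 0" by linarith
    \<comment> \<open>The terms in \<open>c\<close> combine to the Cayley transform
      \<open>Q\<close>, while in those in \<open>Y w\<close> the factor
      \<open>1 + \<omega> w\<close> cancels. All real parts are then nonnegative.\<close>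
    have "u' w - v' w = of_real c * Q + Y w"
    proof -
      have "1 / e * (r + t) - x / e * (r - t) = r * ((1 - x) / e) + (1 + x) / e * t" for e r t x :: complex
        by (simp add: divide_inverse algebra_simps)
      then show ?thesis unfolding u'_def v'_def Q_def using ne[OF w] by simp
    qed
    then have "Re (u' w - v' w) = c * Re Q + Re (Y w)" by simp
    moreover have "c * Re Q \<ge> 0" using c Q by simp
    ultimately show "Re (u' w - v' w) \<ge> b * (sin (\<beta> - 2 * (sin \<beta> * Re w)) / sin \<beta>)"
      using Y bK \<open>b * n / 2 * Re Q \<ge> 0\<close> by linarith
  qed
  have lt: "cmod (v' w) < cmod (u' w)" if w: "w \<in> vertical_strip \<beta>" for w
  proof -
    have "Re (of_real c + Y w) > 0" using ReY[OF w] c by simp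
    then have pos: "cmod (of_real c + Y w) > 0" using complex_Re_le_cmod by (rule less_le_trans)
    have "cmod (\<omega> w) * cmod (of_real c - Y w) \<le> cmod (\<omega> w) * cmod (of_real c + Y w)"
      using norm_diff_le_norm_add[OF c, of "Y w"] ReY[OF w] by (intro mult_left_mono) auto
    also have "\<dots> < 1 * cmod (of_real c + Y w)"
      using norm\<omega>[OF w] pos by (intro mult_strict_right_mono)
    finally show ?thesis
      using ne[OF w] by (simp add: u'_def v'_def norm_mult norm_divide divide_strict_right_mono)
  qed
  have low: "\<exists>m>0. \<forall>t. m \<le> Re (u' (Complex x t) - v' (Complex x t))"
    if "(\<beta> - pi) / (2 * sin \<beta>) < x" "x < \<beta> / (2 * sin \<beta>)" for x
  proof (intro exI conjI allI)
    have S: "Complex x t \<in> vertical_strip \<beta>" for t using that by (simp add: vertical_strip_def)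
    show "b * (sin (\<beta> - 2 * (sin \<beta> * x)) / sin \<beta>) > 0"
      using Re_strip_log_scale_deriv_ge(2)[OF \<beta> S] b by (intro mult_pos_pos) auto
    show "b * (sin (\<beta> - 2 * (sin \<beta> * x)) / sin \<beta>) \<le> Re (u' (Complex x t) - v' (Complex x t))" for t
      using Re_diff[OF S[of t]] by simp
  qed
  show "inj_on N (vertical_strip \<beta>)"
    unfolding N_def vertical_strip_def
    by (rule shear_of_strip[OF derivs lt low]) (simp_all add: vertical_strip_def)
  show "connected (N ` vertical_strip \<beta> \<inter> {w. Im w = y})"
    unfolding N_def vertical_strip_def
    by (rule shear_of_strip[OF derivs lt low]) (simp_all add: vertical_strip_def)
qed

section \<open>Transfer to given canonical parts, and identification of both mappings\<close>

lemma canonical_decomp_deriv_unique: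
  assumes "canonical_decomp f h g" "canonical_decomp f h' g'" "z \<in> unit_disc"
  shows "deriv h z = deriv h' z" "deriv g z = deriv g' z"
proof -
  have "\<forall>\<^sub>F w in nhds z. w \<in> unit_disc"
    using assms(3) by (intro eventually_nhds_in_open) auto
  then have "\<forall>\<^sub>F w in nhds z. h w = h' w" "\<forall>\<^sub>F w in nhds z. g w = g' w"
    using canonical_decomp_unique[OF assms(1,2)] by (auto elim: eventually_mono)
  then show "deriv h z = deriv h' z" "deriv g z = deriv g' z"
    by (auto intro: deriv_cong_ev)
qed

text \<open>The class definitions only assert that some pair of parts exists; uniqueness carries the
  inequality over to the pair at hand.\<close>

lemma sense_preserving_deriv_less:
  assumes "sense_preserving f" "canonical_decomp f h g" "z \<in> unit_disc"
  shows "cmod (deriv g z) < cmod (deriv h z)"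
proof -
  obtain h' g' where f: "canonical_decomp f h' g'"
    and less: "\<forall>z\<in>unit_disc. cmod (deriv g' z) < cmod (deriv h' z)"
    using assms(1) by (auto simp: sense_preserving_def)
  from less assms(3) have "cmod (deriv g' z) < cmod (deriv h' z)" by blast
  then show ?thesis by (simp only: canonical_decomp_deriv_unique[OF f assms(2,3)])
qed

lemma class_H_normalization:
  assumes "f \<in> class_H" "canonical_decomp f h g"
  shows "h 0 = 0" "deriv h 0 = 1"
proof -
  obtain h' g' where f: "canonical_decomp f h' g'" and norm: "h' 0 = 0" "deriv h' 0 = 1"
    using assms(1) by (auto simp: class_H_def)
  have 0: "0 \<in> unit_disc" by simp
  show "h 0 = 0" using canonical_decomp_unique[OF f assms(2) 0] norm by simp
  show "deriv h 0 = 1" using canonical_decomp_deriv_unique(1)[OF f assms(2) 0] norm by simp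
qed

text \<open>The half-plane parts are kernel combinations with weights \<open>1 - b\<close> and
  \<open>b\<close>. The factor \<open>cis (2 * \<gamma>)\<close> of the second part turns
  \<open>cis (- \<gamma>)\<close> into \<open>cis \<gamma>\<close>, so after conjugation both parts
  carry the same rotation.\<close>

lemma halfplane_hadamard_products:
  fixes a \<gamma> :: real
  assumes h: "h holomorphic_on unit_disc" "h 0 = 0" and g: "g holomorphic_on unit_disc" "g 0 = 0"
    and z: "z \<in> unit_disc"
  defines "b \<equiv> (1 - a) / 2"
  shows "hadamard_product h (halfplane_h a \<gamma>) z =
      cis (- \<gamma>) * (of_real (1 - b) * h (cis \<gamma> * z) + of_real b * (cis \<gamma> * z * deriv h (cis \<gamma> * z)))"
    and "hadamard_product g (halfplane_g a \<gamma>) z =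
      cis \<gamma> * (of_real (1 - b) * g (cis \<gamma> * z) - of_real b * (cis \<gamma> * z * deriv g (cis \<gamma> * z)))"
proof -
  have b: "of_real (1 - b) = (1 + of_real a) / (2::complex)" "of_real b = (1 - of_real a) / (2::complex)"
    by (simp_all add: b_def field_simps)
  have cc: "cis (- \<gamma>) * cis \<gamma> = 1" "cis (2 * \<gamma>) * cis (- \<gamma>) = cis \<gamma>" "cis (2 * \<gamma>) = cis \<gamma> * cis \<gamma>"
    by (simp_all add: cis_mult)
  have h_eq: "halfplane_h a \<gamma> = (\<lambda>z. of_real (1 - b) * halfplane_kernel \<gamma> z
      + of_real b * z * deriv (halfplane_kernel \<gamma>) z)"
    unfolding b by (rule ext) (simp add: halfplane_h_def field_simps)
  have g_eq: "halfplane_g a \<gamma> = (\<lambda>z. cis (2 * \<gamma>) * of_real (1 - b) * halfplane_kernel \<gamma> z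
      + (- cis (2 * \<gamma>) * of_real b) * z * deriv (halfplane_kernel \<gamma>) z)"
    unfolding b by (rule ext) (simp add: halfplane_g_def field_simps)
  have "of_real (1 - b) * cis (- \<gamma>) * h (cis \<gamma> * z) + of_real b * z * deriv h (cis \<gamma> * z)
    = of_real (1 - b) * cis (- \<gamma>) * h (cis \<gamma> * z) + (cis (- \<gamma>) * cis \<gamma>) * of_real b * z * deriv h (cis \<gamma> * z)"
    unfolding cc(1) by simp
  also have "\<dots> = cis (- \<gamma>) * (of_real (1 - b) * h (cis \<gamma> * z) + of_real b * (cis \<gamma> * z * deriv h (cis \<gamma> * z)))"
    by (simp only: distrib_left mult_ac)
  finally show "hadamard_product h (halfplane_h a \<gamma>) z =
      cis (- \<gamma>) * (of_real (1 - b) * h (cis \<gamma> * z) + of_real b * (cis \<gamma> * z * deriv h (cis \<gamma> * z)))"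
    unfolding h_eq hadamard_product_kernel_combination[OF h z] .
  have "cis (2 * \<gamma>) * of_real (1 - b) * cis (- \<gamma>) * g (cis \<gamma> * z)
      + (- cis (2 * \<gamma>) * of_real b) * z * deriv g (cis \<gamma> * z)
    = (cis (2 * \<gamma>) * cis (- \<gamma>)) * of_real (1 - b) * g (cis \<gamma> * z)
      - cis (2 * \<gamma>) * of_real b * z * deriv g (cis \<gamma> * z)"
    by (simp add: mult_ac)
  also have "\<dots> = cis \<gamma> * (of_real (1 - b) * g (cis \<gamma> * z) - of_real b * (cis \<gamma> * z * deriv g (cis \<gamma> * z)))"
    unfolding cc(2) unfolding cc(3) by (simp only: right_diff_distrib mult_ac)
  finally show "hadamard_product g (halfplane_g a \<gamma>) z =
      cis \<gamma> * (of_real (1 - b) * g (cis \<gamma> * z) - of_real b * (cis \<gamma> * z * deriv g (cis \<gamma> * z)))"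
    unfolding g_eq hadamard_product_kernel_combination[OF g z] .
qed

text \<open>Only the Taylor coefficients at \<open>0\<close> enter, so agreement near
  \<open>0\<close> suffices.\<close>

lemma hadamard_product_cong:
  assumes "\<And>z. z \<in> unit_disc \<Longrightarrow> H z = H' z"
  shows "hadamard_product h H z = hadamard_product h H' z"
proof -
  have "\<forall>\<^sub>F w in nhds 0. w \<in> unit_disc"
    by (intro eventually_nhds_in_open) auto
  then have "\<forall>\<^sub>F w in nhds 0. H w = H' w"
    by eventually_elim (rule assms)
  then show ?thesis
    unfolding hadamard_product_def by (simp only: fps_expansion_cong)
qed

text \<open>Membership in the strip is decided by the real part, which \<open>f\<close> and
  \<open>h + g\<close> share. The vanishing of \<open>deriv g 0\<close> gives \<open>h + g\<close>
  the normalization required by \<open>strip_to_disc_inverse\<close>.\<close>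

lemma strip_analytic_part_inverse:
  assumes \<beta>: "0 < \<beta>" "\<beta> < pi" and f: "f \<in> strip_mappings \<beta>" "canonical_decomp f h g"
    and dg: "deriv g 0 = 0"
  shows "\<And>z. z \<in> unit_disc \<Longrightarrow> h z + g z \<in> vertical_strip \<beta>"
    and "\<And>z. z \<in> unit_disc \<Longrightarrow> strip_to_disc \<beta> (h z + g z) = z"
proof -
  define k where "k = (\<lambda>z. h z + g z)"
  have hol: "h holomorphic_on unit_disc" "g holomorphic_on unit_disc" and g0: "g 0 = 0"
    and fz: "\<And>z. z \<in> unit_disc \<Longrightarrow> f z = h z + cnj (g z)"
    using f(2) by (auto simp: canonical_decomp_def)
  have H: "f \<in> class_H" and img: "f ` unit_disc = vertical_strip \<beta>"
    using f(1) by (auto simp: strip_mappings_def class_SH0_def class_SH_def)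
  have k: "k z \<in> vertical_strip \<beta>" if "z \<in> unit_disc" for z
  proof -
    have "f z \<in> vertical_strip \<beta>" using img that by blast
    then show ?thesis by (simp add: vertical_strip_def k_def fz[OF that])
  qed
  then show "\<And>z. z \<in> unit_disc \<Longrightarrow> h z + g z \<in> vertical_strip \<beta>" by (simp add: k_def)
  have "deriv k 0 = deriv h 0 + deriv g 0"
    unfolding k_def using hol by (intro deriv_add) (auto intro: holomorphic_on_imp_differentiable_at)
  then have "deriv k 0 = 1" using class_H_normalization[OF H f(2)] dg by simp
  moreover have "k holomorphic_on unit_disc" unfolding k_def by (intro holomorphic_intros hol)
  moreover have "k 0 = 0" using class_H_normalization[OF H f(2)] g0 by (simp add: k_def)
  moreover have "k ` unit_disc \<subseteq> vertical_strip \<beta>" using k by blast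
  ultimately have "strip_to_disc \<beta> (k z) = z" if "z \<in> unit_disc" for z
    using strip_to_disc_inverse[OF \<beta> _ _ _ _ that] by blast
  then show "\<And>z. z \<in> unit_disc \<Longrightarrow> strip_to_disc \<beta> (h z + g z) = z" by (simp add: k_def)
qed

text \<open>The differentiated shear equation and the dilatation form a linear system for the two
  derivatives. Solving it gives the derivative of \<open>halfplane_h\<close>; values at
  \<open>0\<close> fix the constant, and the shear equation then returns \<open>G\<close>.\<close>

lemma halfplane_parts_unique:
  assumes a: "-1 < a" "a < 1"
    and F: "sense_preserving F" "canonical_decomp F H G"
    and shear: "\<And>z. z \<in> unit_disc \<Longrightarrow>
      H z + cis (- 2 * \<gamma>) * G z = (1 + of_real a) * z / (1 - cis \<gamma> * z)"
    and dil: "\<And>z. z \<in> unit_disc \<Longrightarrow> deriv G z / deriv H z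
      = - cis (2 * \<gamma>) * ((cis \<gamma> * z - of_real a) / (1 - of_real a * cis \<gamma> * z))"
    and z: "z \<in> unit_disc"
  shows "H z = halfplane_h a \<gamma> z" "G z = halfplane_g a \<gamma> z"
proof -
  have hol: "H holomorphic_on unit_disc" "G holomorphic_on unit_disc" and G0: "G 0 = 0"
    using F(2) by (auto simp: canonical_decomp_def)
  have a1: "1 + of_real a \<noteq> (0::complex)"
  proof
    assume "1 + of_real a = (0::complex)"
    then have "Re (1 + of_real a) = 0" by (simp only: zero_complex.sel)
    then show False using a by simp
  qed
  have cc: "cis (- 2 * \<gamma>) * cis (2 * \<gamma>) = 1" by (simp add: cis_mult)
  have dH: "deriv H z = (1 - of_real a * cis \<gamma> * z) / (1 - cis \<gamma> * z) ^ 3"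
    if z: "z \<in> unit_disc" for z
  proof -
    define x where "x = cis \<gamma> * z"
    have x1: "1 - x \<noteq> 0" using one_minus_cis_mult_nonzero[OF z] by (simp add: x_def)
    have ax: "1 - of_real a * x \<noteq> 0"
      using dilatation_denominator_nonzero[OF a z, of \<gamma>] by (simp add: x_def mult.assoc)
    \<comment> \<open>Division is total, so the dilatation equation may be cleared of its
      denominator only once this is known.\<close>
    have "deriv H z \<noteq> 0" using sense_preserving_deriv_less[OF F z] by auto
    then have G': "deriv G z = deriv H z * (- cis (2 * \<gamma>) * ((x - of_real a) / (1 - of_real a * x)))"
      using dil[OF z] by (simp add: field_simps x_def)
    have "((\<lambda>z. H z + cis (- 2 * \<gamma>) * G z) has_field_derivative deriv H z + cis (- 2 * \<gamma>) * deriv G z) (at z)"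
      using z by (intro DERIV_add DERIV_cmult holomorphic_derivI[OF hol(1)] holomorphic_derivI[OF hol(2)]) auto
    moreover have "((\<lambda>z. H z + cis (- 2 * \<gamma>) * G z) has_field_derivative (1 + of_real a) / (1 - x)\<^sup>2) (at z)"
    proof (rule has_field_derivative_transform_within_open[OF _ open_ball z])
      show "((\<lambda>z. (1 + of_real a) * z / (1 - cis \<gamma> * z)) has_field_derivative (1 + of_real a) / (1 - x)\<^sup>2) (at z)"
        using x1 unfolding x_def
        by (auto intro!: derivative_eq_intros simp: power2_eq_square divide_simps algebra_simps)
    qed (rule shear[symmetric])
    ultimately have "deriv H z + cis (- 2 * \<gamma>) * deriv G z = (1 + of_real a) / (1 - x)\<^sup>2"
      by (rule DERIV_unique)
    moreover define r where "r = (x - of_real a) / (1 - of_real a * x)"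
    moreover have "cis (- 2 * \<gamma>) * deriv G z = - (cis (- 2 * \<gamma>) * cis (2 * \<gamma>)) * deriv H z * r"
      unfolding G' r_def by (simp add: mult_ac)
    then have "deriv H z + cis (- 2 * \<gamma>) * deriv G z = deriv H z * (1 - r)"
      unfolding cc by (simp add: right_diff_distrib)
    ultimately have "deriv H z * (1 - r) = (1 + of_real a) / (1 - x)\<^sup>2" by simp
    \<comment> \<open>The factor \<open>1 + a\<close> appears here and in the differentiated shear
      equation; it is nonzero and cancels.\<close>
    moreover have "1 - r = (1 + of_real a) * ((1 - x) / (1 - of_real a * x))"
    proof -
      have "1 - r = ((1 - of_real a * x) - (x - of_real a)) / (1 - of_real a * x)"
        unfolding r_def diff_divide_distrib[of "1 - of_real a * x"] using ax by simp
      also have "(1 - of_real a * x) - (x - of_real a) = (1 + of_real a) * (1 - x)"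
        by (simp add: algebra_simps)
      finally show ?thesis by simp
    qed
    ultimately have "(1 + of_real a) * (deriv H z * ((1 - x) / (1 - of_real a * x))) = (1 + of_real a) * (1 / (1 - x)\<^sup>2)"
      by (simp add: mult_ac)
    then have e: "deriv H z * ((1 - x) / (1 - of_real a * x)) = 1 / (1 - x)\<^sup>2"
      using a1 by (simp only: mult_cancel_left) simp
    have "deriv H z = deriv H z * ((1 - x) / (1 - of_real a * x)) * ((1 - of_real a * x) / (1 - x))"
      using ax x1 by simp
    also have "\<dots> = (1 - of_real a * x) / (1 - x) ^ 3"
      unfolding e by (simp add: power2_eq_square power3_eq_cube)
    finally show ?thesis by (simp add: x_def mult.assoc)
  qed
  have "((\<lambda>z. H z - halfplane_h a \<gamma> z) has_field_derivative 0) (at z within unit_disc)" if "z \<in> unit_disc" for z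
    using DERIV_diff[OF holomorphic_derivI[OF hol(1) open_ball that] halfplane_h_g_deriv(1)[OF that, of a \<gamma>]]
    unfolding dH[OF that] by (simp add: has_field_derivative_at_within)
  then obtain d where d: "\<And>z. z \<in> unit_disc \<Longrightarrow> H z - halfplane_h a \<gamma> z = d"
    using has_field_derivative_zero_constant[of unit_disc "\<lambda>z. H z - halfplane_h a \<gamma> z"] by auto
  have "H 0 = 0" using shear[of 0] G0 by simp
  then have "d = 0" using d[of 0] by (simp add: halfplane_h_def halfplane_kernel_def)
  then show Hz: "H z = halfplane_h a \<gamma> z" using d[OF z] by simp
  have "H z + cis (- 2 * \<gamma>) * G z = H z + cis (- 2 * \<gamma>) * halfplane_g a \<gamma> z"
    unfolding shear[OF z] unfolding Hz by (rule halfplane_shear[OF z, symmetric])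
  then show "G z = halfplane_g a \<gamma> z" by (simp only: add_left_cancel mult_cancel_left cis_neq_zero simp_thms)
qed

section \<open>Rotation back to the disc and conclusion\<close>

text \<open>Multiplication by \<open>cis \<gamma>\<close> carries the image of \<open>f\<close> onto
  that of \<open>N\<close>, and the line through \<open>p\<close> with direction
  \<open>cis (- \<gamma>)\<close> onto the horizontal line at height
  \<open>Im (cis \<gamma> * p)\<close>.\<close>

lemma convex_in_direction_rotation:
  assumes "harmonic_mapping f"
    and f: "\<And>z. z \<in> unit_disc \<Longrightarrow> f z = cis (- \<gamma>) * N (k (cis \<gamma> * z))"
    and k: "bij_betw k unit_disc S" and inj: "inj_on N S"
    and sect: "\<And>y. connected (N ` S \<inter> {w. Im w = y})"
  shows "convex_in_direction f (- \<gamma>)"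
proof -
  have cc: "cis \<gamma> * cis (- \<gamma>) = 1" by (simp add: cis_mult)
  have rot: "cis \<delta> * z \<in> unit_disc" if "z \<in> unit_disc" for \<delta> z
    using that by (simp add: norm_mult)
  have kS: "k ` unit_disc = S" and injk: "inj_on k unit_disc"
    using k by (auto simp: bij_betw_def)
  have "inj_on f unit_disc"
  proof (rule inj_onI)
    fix x y assume x: "x \<in> unit_disc" and y: "y \<in> unit_disc" and "f x = f y"
    then have "N (k (cis \<gamma> * x)) = N (k (cis \<gamma> * y))" by (simp add: f)
    then have "k (cis \<gamma> * x) = k (cis \<gamma> * y)"
      using rot[OF x] rot[OF y] kS inj by (meson imageI inj_onD)
    then have "cis \<gamma> * x = cis \<gamma> * y"
      using rot[OF x] rot[OF y] injk by (meson inj_onD)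
    then show "x = y" by simp
  qed
  moreover have "connected (f ` unit_disc \<inter> range (\<lambda>t::real. p + of_real t * cis (- \<gamma>)))" for p
  proof -
    have "connected ((\<lambda>w. cis (- \<gamma>) * w) ` (N ` S \<inter> {w. Im w = Im (cis \<gamma> * p)}))"
      by (intro connected_continuous_image sect continuous_intros)
    moreover have "(\<lambda>w. cis (- \<gamma>) * w) ` (N ` S \<inter> {w. Im w = Im (cis \<gamma> * p)})
        = f ` unit_disc \<inter> range (\<lambda>t::real. p + of_real t * cis (- \<gamma>))"
    proof (intro equalityI subsetI)
      fix x assume "x \<in> (\<lambda>w. cis (- \<gamma>) * w) ` (N ` S \<inter> {w. Im w = Im (cis \<gamma> * p)})"
      then obtain w where w: "w \<in> S" "x = cis (- \<gamma>) * N w" "Im (N w) = Im (cis \<gamma> * p)" by auto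
      obtain z where z: "z \<in> unit_disc" "w = k z" using w(1) kS by auto
      have "cis \<gamma> * (cis (- \<gamma>) * z) = z" unfolding mult.assoc[symmetric] cc by simp
      then have "x = f (cis (- \<gamma>) * z)"
        using f[OF rot[OF z(1)], of "- \<gamma>"] w(2) z(2) by (simp only:)
      then have "x \<in> f ` unit_disc" using rot[OF z(1)] by blast
      moreover have "x = p + of_real (Re (N w) - Re (cis \<gamma> * p)) * cis (- \<gamma>)"
      proof -
        have "N w = cis \<gamma> * p + of_real (Re (N w) - Re (cis \<gamma> * p))"
          using w(3) by (simp add: complex_eq_iff)
        then have "x = cis (- \<gamma>) * (cis \<gamma> * p + of_real (Re (N w) - Re (cis \<gamma> * p)))"
          using w(2) by simp
        also have "\<dots> = (cis \<gamma> * cis (- \<gamma>)) * p + of_real (Re (N w) - Re (cis \<gamma> * p)) * cis (- \<gamma>)"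
          by (simp only: distrib_left mult_ac)
        finally show ?thesis unfolding cc by simp
      qed
      ultimately show "x \<in> f ` unit_disc \<inter> range (\<lambda>t::real. p + of_real t * cis (- \<gamma>))" by blast
    next
      fix x assume "x \<in> f ` unit_disc \<inter> range (\<lambda>t::real. p + of_real t * cis (- \<gamma>))"
      then obtain z t where z: "z \<in> unit_disc" "x = f z" and t: "x = p + of_real t * cis (- \<gamma>)" by auto
      define w where "w = N (k (cis \<gamma> * z))"
      have x: "x = cis (- \<gamma>) * w" using f[OF z(1)] z(2) by (simp add: w_def)
      have "w = (cis \<gamma> * cis (- \<gamma>)) * w" using cc by simp
      also have "\<dots> = cis \<gamma> * x" using x by (simp only: mult.assoc)
      also have "\<dots> = cis \<gamma> * p + of_real t * (cis \<gamma> * cis (- \<gamma>))"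
        unfolding t by (simp only: distrib_left mult_ac)
      finally have "Im w = Im (cis \<gamma> * p)" unfolding cc by simp
      moreover have "w \<in> N ` S" using rot[OF z(1)] kS by (auto simp: w_def)
      ultimately show "x \<in> (\<lambda>w. cis (- \<gamma>) * w) ` (N ` S \<inter> {w. Im w = Im (cis \<gamma> * p)})"
        using x by blast
    qed
    ultimately show ?thesis by simp
  qed
  ultimately show ?thesis using assms(1) by (simp add: convex_in_direction_def)
qed

theorem theorem3:
  fixes \<beta> \<gamma> \<theta> a :: real and n :: nat
    and f h g F H G :: "complex \<Rightarrow> complex"
  assumes "0 < \<beta>" and "\<beta> < pi"
    and "0 \<le> \<gamma>" and "\<gamma> < 2 * pi"
    and "n \<ge> 1"
    and "f \<in> strip_mappings \<beta>"
    and "canonical_decomp f h g"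
    and "\<And>z. z \<in> unit_disc \<Longrightarrow> deriv g z / deriv h z = cis \<theta> * z ^ n"
    and "a \<in> {(real n - 2) / (real n + 2)..<1}"
    and "F \<in> halfplane_mappings \<gamma>"
    and "canonical_decomp F H G"
    and "\<And>z. z \<in> unit_disc \<Longrightarrow>
           H z + cis (- 2 * \<gamma>) * G z = (1 + of_real a) * z / (1 - cis \<gamma> * z)"
    and "\<And>z. z \<in> unit_disc \<Longrightarrow>
           deriv G z / deriv H z
             = - cis (2 * \<gamma>) * ((cis \<gamma> * z - of_real a) / (1 - of_real a * cis \<gamma> * z))"
  shows "convex_in_direction (harmonic_convolution h g H G) (- \<gamma>)"
proof -
  note \<beta> = assms(1,2) and dec = assms(7) and dil = assms(8)
  \<comment> \<open>The weight of z d/dz in \<open>halfplane_h\<close>; the kernel itself has weight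
    \<open>1 - b\<close>.\<close>
  define b where "b = (1 - a) / 2"
  have a: "-1 < a" "a < 1" and b: "0 < b" "b + b * n / 2 \<le> 1"
  proof -
    show "a < 1" using assms(9) by simp
    have "(real n - 2) / (real n + 2) \<le> a" using assms(9) by simp
    then have le: "real n - 2 \<le> a * (real n + 2)" by (simp add: pos_divide_le_eq)
    \<comment> \<open>This is exactly the lower bound on \<^term>\<open>a\<close>.\<close>
    then show "b + b * n / 2 \<le> 1" by (simp add: b_def field_simps)
    \<comment> \<open>For \<open>n \<ge> 1\<close> the left endpoint of the interval for
      \<open>a\<close> already exceeds -1.\<close>
    show "-1 < a"
    proof (rule ccontr)
      assume "\<not> -1 < a"
      then have "a * (real n + 2) \<le> -1 * (real n + 2)" by (intro mult_right_mono) auto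
      with le \<open>n \<ge> 1\<close> show False by simp
    qed
    show "0 < b" using \<open>a < 1\<close> by (simp add: b_def)
  qed
  have hol: "h holomorphic_on unit_disc" "g holomorphic_on unit_disc" and g0: "g 0 = 0"
    using dec by (auto simp: canonical_decomp_def)
  have f: "f \<in> class_H" "sense_preserving f" and F: "sense_preserving F"
    using assms(6,10) by (auto simp: strip_mappings_def halfplane_mappings_def class_SH0_def class_SH_def)
  note norm = class_H_normalization[OF f(1) dec]
  have dg: "deriv g z = cis \<theta> * z ^ n * deriv h z" if "z \<in> unit_disc" for z
  proof -
    have "deriv h z \<noteq> 0" using sense_preserving_deriv_less[OF f(2) dec that] by auto
    then show ?thesis unfolding dil[OF that, symmetric] by simp
  qed
  have dg0: "deriv g 0 = 0" using dg[of 0] \<open>n \<ge> 1\<close> by simp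
  define k where "k z = h z + g z" for z
  note k = strip_analytic_part_inverse[OF \<beta> assms(6) dec dg0, folded k_def]
  let ?Z = "strip_to_disc \<beta>"
  have Zk: "?Z w \<in> unit_disc" "k (?Z w) = w" if w: "w \<in> vertical_strip \<beta>" for w
  proof -
    show Z: "?Z w \<in> unit_disc" using norm_strip_to_disc_less_1[OF \<beta> w] by simp
    \<comment> \<open>Both sides have the same image under the injective \<open>?Z\<close>, because
      \<open>?Z (k z) = z\<close> on the disc.\<close>
    show "k (?Z w) = w"
      using inj_onD[OF inj_on_strip_to_disc[OF \<beta>] k(2)[OF Z] k(1)[OF Z] w] .
  qed
  have bij: "bij_betw k unit_disc (vertical_strip \<beta>)"
    by (rule bij_betw_byWitness[where f' = ?Z]) (use k Zk in auto)
  define \<omega> where "\<omega> = (\<lambda>w. cis \<theta> * ?Z w ^ n)"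
  define Z' where "Z' w = (of_real (sin \<beta>))\<^sup>2 / (sin (of_real \<beta> - of_real (sin \<beta>) * w))\<^sup>2" for w :: complex
  have dZ: "(?Z has_field_derivative Z' w) (at w)" if "w \<in> vertical_strip \<beta>" for w
    unfolding Z'_def by (rule strip_to_disc_deriv[OF \<beta> that])
  \<comment> \<open>Differentiating \<open>?Z (k z) = z\<close> at \<open>?Z w\<close> and
    substituting g' = \<omega> h' leaves one linear equation for h'.\<close>
  have chain: "deriv h (?Z w) * Z' w = 1 / (1 + \<omega> w)" if w: "w \<in> vertical_strip \<beta>" for w
  proof -
    have "((\<lambda>z. ?Z (k z)) has_field_derivative Z' w * (deriv h (?Z w) + deriv g (?Z w))) (at (?Z w))"
      unfolding k_def
      by (rule DERIV_chain2[where f = ?Z])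
         (use Zk[OF w] dZ[OF w] in \<open>auto simp: k_def intro!: DERIV_add holomorphic_derivI[OF hol(1)] holomorphic_derivI[OF hol(2)]\<close>)
    moreover have "((\<lambda>z. ?Z (k z)) has_field_derivative 1) (at (?Z w))"
      by (rule has_field_derivative_transform_within_open[OF DERIV_ident open_ball Zk(1)[OF w]]) (simp add: k)
    ultimately have "Z' w * (deriv h (?Z w) + deriv g (?Z w)) = 1" by (rule DERIV_unique)
    then have e: "deriv h (?Z w) * Z' w * (1 + \<omega> w) = 1"
      unfolding dg[OF Zk(1)[OF w]] by (simp add: \<omega>_def algebra_simps)
    then have "1 + \<omega> w \<noteq> 0" by auto
    with e show ?thesis by (simp add: field_simps)
  qed
  have chain_g: "deriv g (?Z w) * Z' w = \<omega> w / (1 + \<omega> w)" if w: "w \<in> vertical_strip \<beta>" for w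
    using chain[OF w] unfolding dg[OF Zk(1)[OF w]] \<omega>_def by (simp add: mult.assoc)
  have U: "((\<lambda>w. h (?Z w)) has_field_derivative 1 / (1 + \<omega> w)) (at w)"
    and V: "((\<lambda>w. g (?Z w)) has_field_derivative \<omega> w / (1 + \<omega> w)) (at w)"
    if w: "w \<in> vertical_strip \<beta>" for w
    unfolding chain[OF w, symmetric] chain_g[OF w, symmetric]
    by (rule DERIV_chain2[OF holomorphic_derivI[OF hol(1) open_ball Zk(1)[OF w]] dZ[OF w]],
        rule DERIV_chain2[OF holomorphic_derivI[OF hol(2) open_ball Zk(1)[OF w]] dZ[OF w]])
  define N where "N = (\<lambda>w. of_real (1 - b) * h (?Z w) + of_real b * (strip_log_scale \<beta> w * (1 / (1 + \<omega> w)))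
    + cnj (of_real (1 - b) * g (?Z w) - of_real b * (strip_log_scale \<beta> w * (\<omega> w / (1 + \<omega> w)))))"
  have inj: "inj_on N (vertical_strip \<beta>)"
    and sect: "connected (N ` vertical_strip \<beta> \<inter> {w. Im w = y})" for y
    unfolding N_def \<omega>_def
    by (rule strip_convolution_shear[OF \<beta> b \<open>n \<ge> 1\<close>,
          where U = "\<lambda>w. h (?Z w)" and V = "\<lambda>w. g (?Z w)"];
        use U V in \<open>simp add: \<omega>_def\<close>)+
  have H: "H z = halfplane_h a \<gamma> z" and G: "G z = halfplane_g a \<gamma> z" if "z \<in> unit_disc" for z
    using halfplane_parts_unique[OF a F assms(11-13) that] by auto
  define u where "u z = of_real (1 - b) * h z + of_real b * (z * deriv h z)" for z
  define v where "v z = of_real (1 - b) * g z - of_real b * (z * deriv g z)" for z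
  have conv_h: "hadamard_product h H z = cis (- \<gamma>) * u (cis \<gamma> * z)"
    and conv_g: "hadamard_product g G z = cis \<gamma> * v (cis \<gamma> * z)" if z: "z \<in> unit_disc" for z
    using halfplane_hadamard_products[OF hol(1) norm(1) hol(2) g0 z, of a \<gamma>]
      hadamard_product_cong[of H, OF H, of h z] hadamard_product_cong[of G, OF G, of g z]
    by (simp_all add: u_def v_def b_def)
  have rot: "cis \<gamma> * z \<in> unit_disc" if "z \<in> unit_disc" for z
    using that by (simp add: norm_mult)
  have N: "N (k z) = u z + cnj (v z)" if z: "z \<in> unit_disc" for z
  proof -
    note kz = k(1)[OF z]
    \<comment> \<open>The scale \<kappa> times Z' is Z, and Z at \<open>k z\<close> is
      \<open>z\<close>; this turns the strip expressions back into z h'(z) and z g'(z).\<close>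
    have s: "strip_log_scale \<beta> (k z) * Z' (k z) = z"
      unfolding Z'_def strip_log_scale_mult_deriv[OF \<beta> kz] by (rule k(2)[OF z])
    have "strip_log_scale \<beta> (k z) * (1 / (1 + \<omega> (k z))) = (strip_log_scale \<beta> (k z) * Z' (k z)) * deriv h z"
      and "strip_log_scale \<beta> (k z) * (\<omega> (k z) / (1 + \<omega> (k z))) = (strip_log_scale \<beta> (k z) * Z' (k z)) * deriv g z"
      unfolding chain[OF kz, symmetric] chain_g[OF kz, symmetric] k(2)[OF z] by (simp_all only: mult_ac)
    then show ?thesis unfolding N_def u_def v_def s k(2)[OF z] by simp
  qed
  have conv: "harmonic_convolution h g H G z = cis (- \<gamma>) * N (k (cis \<gamma> * z))" if z: "z \<in> unit_disc" for z
    unfolding harmonic_convolution_def conv_h[OF z] conv_g[OF z] N[OF rot[OF z]]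
    by (simp add: cis_cnj distrib_left)
  \<comment> \<open>Convexity in a direction includes harmonicity; the rotated \<open>u\<close> and
    \<open>v\<close> serve as explicit canonical parts.\<close>
  have "canonical_decomp (harmonic_convolution h g H G)
      (\<lambda>z. cis (- \<gamma>) * u (cis \<gamma> * z)) (\<lambda>z. cis \<gamma> * v (cis \<gamma> * z))"
  proof -
    have rot_hol: "(\<lambda>z. \<phi> (cis \<gamma> * z)) holomorphic_on unit_disc" if "\<phi> holomorphic_on unit_disc" for \<phi>
    proof -
      have "(*) (cis \<gamma>) ` unit_disc \<subseteq> unit_disc" using rot by blast
      moreover have "(*) (cis \<gamma>) holomorphic_on unit_disc" by (intro holomorphic_intros)
      ultimately show ?thesis using holomorphic_on_compose_gen that by (fastforce simp: o_def)
    qed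
    have "u holomorphic_on unit_disc" "v holomorphic_on unit_disc"
      unfolding u_def v_def by (auto intro!: holomorphic_intros hol)
    moreover have "v 0 = 0" using g0 by (simp add: v_def)
    ultimately show ?thesis
      using conv_h conv_g unfolding canonical_decomp_def harmonic_convolution_def
      by (auto intro!: holomorphic_intros rot_hol)
  qed
  then have "harmonic_mapping (harmonic_convolution h g H G)"
    unfolding harmonic_mapping_def by blast
  then show ?thesis
    using convex_in_direction_rotation[where N = N and k = k, OF _ conv bij inj sect] by blast
qed

end
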